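(* Let $\lambda\in(0,1]$, $\rho(k)=\sum_{i=0}^{k-1}\lambda^{i}$ and $\beta(k)=\sum_{i=0}^{k-1}\lambda^{-i}$. Let $\mathcal{A}$ be a learning-augmented, locally-consistent, memory-constrained deterministic online algorithm for the $k$-server problem on the line. Then, if $\mathcal{A}$ is $\rho(k)$-consistent, it is not $\beta'$-robust for any $\beta'<\beta(k)$ (i.e., it is at least $\beta(k)$-robust).
   Context: The $k$-server problem on the line: $k$ servers start at given positions on $\mathbb{R}$ (initial configuration); requests $r_1,\dots,r_n\in\mathbb{R}$ arrive online, each must be served by moving a server to it before the next one is revealed; cost is total distance traveled. Servers are labeled by position $s_1\le\dots\le s_k$. $\mathrm{OPT}(I)$ is the optimal offline cost. A prediction is a sequence $p_1,\dots,p_n\in\{1,\dots,k\}$ indicating the predicted server $s_{p_t}$ for request $t$; FtP serves each request by the predicted server, and the prediction error is $\eta=\mathrm{FtP}(I)-\mathrm{OPT}(I)$. An algorithm is $\alpha$-consistent if $\mathcal{A}(I)\le\alpha\,\mathrm{OPT}(I)+c$ whenever $\eta=0$, and $\beta$-robust if $\mathcal{A}(I)\le\beta\,\mathrm{OPT}(I)+c$ for all instances and predictions, with $c$ depending only on the initial configuration. Memory-constrained: each decision depends only on the current configuration, current request and current prediction; several servers may move per request; and for any $k$ distinct points and any configuration there is a finite request sequence among these points (a force) after which each point holds exactly one server. Locally-consistent: suppose $\mathcal{A}$ is $\mu(k')$-consistent for the $k'$-server problem for every $k'$. Given an instance $I$ served by $\mathcal{A}$ and any set $S'$ of $k'$ consecutive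 servers, build a $k'$-server instance $I'$: each request of $I$ predicted to be served by a server of $S'$ is copied to $I'$; any other request is replaced by a request at the position of the closest server of $S'$ after $\mathcal{A}$ served that request in $I$. Let $\mathrm{FtP}(I')$ be the cost of serving $I'$ following the original predictions (using the closest server of $S'$ when the predicted server is outside $S'$). $\mathcal{A}$ is locally-consistent if its total cost on $I$ restricted to the servers of $S'$ is at most $\mu(k')\cdot\mathrm{FtP}(I')+c$, where $c$ can be bounded in terms of the initial configuration only, and $c=O(k'\varepsilon)$ if the initial and final configurations differ by total distance $\varepsilon$. *)

theory Defs
  imports Main "HOL-Library.Multiset" Complex_Main
begin

text \<open>k-server on the line. A configuration is a list of k server positions;
  servers are labelled by position, i.e. server i (1-based) is the i-th smallest
  entry. A memory-constrained deterministic online algorithm is a step function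
  mapping (current configuration, current request, current prediction) to the
  next configuration. Predictions are labels in 1..k.\<close>

type_synonym config = "real list"
type_synonym alg = "config \<Rightarrow> real \<Rightarrow> nat \<Rightarrow> config"

definition valid_config :: "nat \<Rightarrow> config \<Rightarrow> bool" where
  "valid_config k C \<longleftrightarrow> length C = k \<and> sorted C"

definition valid_preds :: "nat \<Rightarrow> nat list \<Rightarrow> bool" where
  "valid_preds k ps \<longleftrightarrow> (\<forall>p\<in>set ps. 1 \<le> p \<and> p \<le> k)"

definition move_cost_on :: "nat set \<Rightarrow> config \<Rightarrow> config \<Rightarrow> real" where
  "move_cost_on I C D = (\<Sum>i\<in>I. \<bar>sort C ! i - sort D ! i\<bar>)"

definition move_cost :: "config \<Rightarrow> config \<Rightarrow> real" where
  "move_cost C D = move_cost_on {..<length C} C D"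

fun path_cost_on :: "nat set \<Rightarrow> config list \<Rightarrow> real" where
  "path_cost_on I (C # D # Cs) = move_cost_on I C D + path_cost_on I (D # Cs)"
| "path_cost_on I _ = 0"

definition path_cost :: "config list \<Rightarrow> real" where
  "path_cost Cs = path_cost_on {..<length (hd Cs)} Cs"

text \<open>Run of the algorithm: list of configurations, starting with the initial one;
  element t+1 is the configuration after serving request t.\<close>
fun alg_run :: "alg \<Rightarrow> config \<Rightarrow> real list \<Rightarrow> nat list \<Rightarrow> config list" where
  "alg_run A C (r # rs) (p # ps) = C # alg_run A (A C r p) rs ps"
| "alg_run A C _ _ = [C]"

definition alg_cost :: "alg \<Rightarrow> config \<Rightarrow> real list \<Rightarrow> nat list \<Rightarrow> real" where
  "alg_cost A C rs ps = path_cost (alg_run A C rs ps)"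

definition OPT :: "config \<Rightarrow> real list \<Rightarrow> real" where
  "OPT C rs = Inf {path_cost (C # Ds) | Ds. length Ds = length rs \<and>
      (\<forall>t<length rs. length (Ds ! t) = length C \<and> rs ! t \<in> set (Ds ! t))}"

fun ftp_cost :: "config \<Rightarrow> real list \<Rightarrow> nat list \<Rightarrow> real" where
  "ftp_cost C (r # rs) (p # ps) =
     \<bar>sort C ! (p - 1) - r\<bar> + ftp_cost (sort ((sort C)[p - 1 := r])) rs ps"
| "ftp_cost C _ _ = 0"

definition pred_error :: "config \<Rightarrow> real list \<Rightarrow> nat list \<Rightarrow> real" where
  "pred_error C rs ps = ftp_cost C rs ps - OPT C rs"

definition valid_instance :: "nat \<Rightarrow> config \<Rightarrow> real list \<Rightarrow> nat list \<Rightarrow> bool" where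
  "valid_instance k C rs ps \<longleftrightarrow> valid_config k C \<and> length ps = length rs \<and> valid_preds k ps"

definition valid_alg :: "alg \<Rightarrow> bool" where
  "valid_alg A \<longleftrightarrow> (\<forall>C r p. sorted C \<longrightarrow> 1 \<le> p \<longrightarrow> p \<le> length C \<longrightarrow>
      length (A C r p) = length C \<and> sorted (A C r p) \<and> r \<in> set (A C r p))"

definition consistent :: "nat \<Rightarrow> real \<Rightarrow> alg \<Rightarrow> bool" where
  "consistent k \<alpha> A \<longleftrightarrow> (\<forall>C. valid_config k C \<longrightarrow> (\<exists>c. \<forall>rs ps.
      valid_instance k C rs ps \<longrightarrow> pred_error C rs ps = 0 \<longrightarrow>
      alg_cost A C rs ps \<le> \<alpha> * OPT C rs + c))"

definition robust :: "nat \<Rightarrow> real \<Rightarrow> alg \<Rightarrow> bool" where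
  "robust k \<beta> A \<longleftrightarrow> (\<forall>C. valid_config k C \<longrightarrow> (\<exists>c. \<forall>rs ps.
      valid_instance k C rs ps \<longrightarrow> alg_cost A C rs ps \<le> \<beta> * OPT C rs + c))"

text \<open>Memory-constrained: the decision form is built into the type alg; in addition
  forces must exist: for any k distinct points and any configuration there is a
  finite (predicted) request sequence among these points after which each point
  holds exactly one server.\<close>
definition memory_constrained :: "alg \<Rightarrow> bool" where
  "memory_constrained A \<longleftrightarrow> (\<forall>k xs C. 1 \<le> k \<longrightarrow> length xs = k \<longrightarrow> distinct xs \<longrightarrow>
      valid_config k C \<longrightarrow> (\<exists>rs ps. length ps = length rs \<and> valid_preds k ps \<and>
        set rs \<subseteq> set xs \<and> last (alg_run A C rs ps) = sort xs))"

definition closest :: "real list \<Rightarrow> real \<Rightarrow> real" where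
  "closest xs r = (ARG_MIN (\<lambda>x. \<bar>x - r\<bar>) x. x \<in> set xs)"

text \<open>Local instance I' for the window S' of labels j+1..j+k' (1-based),
  i.e. 0-based indices j..j+k'-1.\<close>
definition local_req :: "alg \<Rightarrow> config \<Rightarrow> real list \<Rightarrow> nat list \<Rightarrow> nat \<Rightarrow> nat \<Rightarrow> real list" where
  "local_req A C rs ps j k' = map (\<lambda>t. if j < ps ! t \<and> ps ! t \<le> j + k' then rs ! t
      else closest (take k' (drop j (sort (alg_run A C rs ps ! Suc t)))) (rs ! t)) [0..<length rs]"

definition local_pred :: "nat list \<Rightarrow> nat \<Rightarrow> nat \<Rightarrow> nat list" where
  "local_pred ps j k' = map (\<lambda>p. if p \<le> j then 1 else if j + k' < p then k' else p - j) ps"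

definition locally_consistent :: "(nat \<Rightarrow> real) \<Rightarrow> alg \<Rightarrow> bool" where
  "locally_consistent \<mu> A \<longleftrightarrow> (\<forall>k'\<ge>1. consistent k' (\<mu> k') A) \<and>
    (\<exists>K\<ge>0. \<exists>f :: config \<Rightarrow> real. \<forall>k C rs ps j k'.
       valid_instance k C rs ps \<longrightarrow> 1 \<le> k' \<longrightarrow> j + k' \<le> k \<longrightarrow>
       path_cost_on {j..<j+k'} (alg_run A C rs ps)
         \<le> \<mu> k' * ftp_cost (take k' (drop j C)) (local_req A C rs ps j k') (local_pred ps j k')
           + min (f C) (K * real k' * move_cost C (last (alg_run A C rs ps))))"

definition rho :: "real \<Rightarrow> nat \<Rightarrow> real" where
  "rho lam k = (\<Sum>i<k. lam ^ i)"

definition beta :: "real \<Rightarrow> nat \<Rightarrow> real" where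
  "beta lam k = (\<Sum>i<k. (1 / lam) ^ i)"

end

theory Submission
  imports Defs
begin

text \<open>Requests near the left end, predicted for server 1, alternate between the points 0 and 1.
  Whenever a server \<open>j\<close> with \<open>1 < j < k\<close> leaves its home, a request at that home predicted for \<open>j\<close>
  calls it back, and whenever server \<open>k\<close> has come down to the home of server \<open>k - 1\<close>, a request at
  distance 1 predicted for \<open>k\<close> sends it back. The optimum can keep servers on all points but the
  last one, so it pays only 2 for each such event, as much as server \<open>k\<close> itself.

  For the servers \<open>j, \<dots>, k\<close> the local instance essentially lets server \<open>j\<close> copy the moves of the
  algorithm and leaves the others at home. With \<open>V\<close> denoting the distances travelled, local
  consistency gives \<open>V j + \<dots> + V k \<le> \<rho>(k - j + 1) V j\<close> up to a constant, and multiplying these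
  inequalities yields a total cost of at least \<open>\<beta>(k) V k\<close>.

  The homes must be so far apart that no server can take over the role of another one. This uses that
  the additive term of local consistency vanishes on round trips: serving requests at a fixed
  configuration costs at most \<open>2 \<rho>(k)\<close> times the distance to it.\<close>

section \<open>Sorted matchings on the line\<close>

definition l1_dist :: "real list \<Rightarrow> real list \<Rightarrow> real" where
  "l1_dist xs ys = (\<Sum>i<length xs. \<bar>xs ! i - ys ! i\<bar>)"

lemma l1_dist_Nil [simp]: "l1_dist [] ys = 0"
  by (simp add: l1_dist_def)

lemma l1_dist_Cons [simp]: "l1_dist (x # xs) (y # ys) = \<bar>x - y\<bar> + l1_dist xs ys"
  unfolding l1_dist_def length_Cons sum.lessThan_Suc_shift by simp

lemma move_cost_eq_l1: "move_cost xs ys = l1_dist (sort xs) (sort ys)"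
  by (simp add: move_cost_def move_cost_on_def l1_dist_def)

lemma move_cost_nonneg: "0 \<le> move_cost xs ys"
  by (simp add: move_cost_def move_cost_on_def sum_nonneg)

lemma move_cost_sorted: "sorted xs \<Longrightarrow> sorted ys \<Longrightarrow> move_cost xs ys = l1_dist xs ys"
  by (simp add: move_cost_eq_l1 sorted_sort_id)

lemma move_cost_sort_left [simp]: "move_cost (sort xs) ys = move_cost xs ys"
  by (simp add: move_cost_eq_l1 sorted_sort_id)

lemma move_cost_commute: "length xs = length ys \<Longrightarrow> move_cost xs ys = move_cost ys xs"
  by (simp add: move_cost_def move_cost_on_def abs_minus_commute)

lemma move_cost_triangle:
  assumes "length xs = length ys"
  shows "move_cost xs zs \<le> move_cost xs ys + move_cost ys zs"
  using assms by (auto simp: move_cost_def move_cost_on_def simp flip: sum.distrib intro!: sum_mono)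

text \<open>Uncrossing: when only one of the new entries comes before the head of its list, pairing
  \<open>a\<close> with \<open>y\<close> and \<open>x\<close> with \<open>b\<close> is no longer
  than pairing \<open>a\<close> with \<open>b\<close> and \<open>x\<close> with
  \<open>y\<close>.\<close>

lemma l1_dist_insort:
  assumes "sorted xs" "sorted ys" "length xs = length ys"
  shows "l1_dist (insort a xs) (insort b ys) \<le> \<bar>a - b\<bar> + l1_dist xs ys"
  using assms
proof (induction xs arbitrary: ys a b)
  case Nil
  then show ?case by simp
next
  case (Cons x xs zs)
  then obtain y ys where zs: "zs = y # ys" "length xs = length ys" "sorted xs" "sorted ys"
    by (cases zs) auto
  have IH: "l1_dist (insort a xs) (insort b ys) \<le> \<bar>a - b\<bar> + l1_dist xs ys" for a b
    using Cons.IH zs by blast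
  have x: "insort x xs = x # xs" and y: "insort y ys = y # ys"
    using Cons.prems zs by (auto simp: insort_is_Cons)
  show ?case
    using IH[of a b] IH[of x b] IH[of a y] by (auto simp: zs x y)
qed

text \<open>This makes re-sorting harmless: a bound for any pairing of the servers, such as the one
  after updating a single entry, also bounds the distance of the configurations.\<close>

lemma move_cost_le_l1:
  "length xs = length ys \<Longrightarrow> move_cost xs ys \<le> l1_dist xs ys"
proof (induction xs ys rule: list_induct2)
  case (Cons x xs y ys)
  have "l1_dist (insort x (sort xs)) (insort y (sort ys)) \<le> \<bar>x - y\<bar> + l1_dist (sort xs) (sort ys)"
    using Cons.hyps by (intro l1_dist_insort) auto
  with Cons.IH show ?case by (simp add: move_cost_eq_l1)
qed (simp add: move_cost_eq_l1)

lemma l1_dist_update: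
  assumes "p < length xs"
  shows "l1_dist (xs[p := r]) ys = l1_dist xs ys - \<bar>xs ! p - ys ! p\<bar> + \<bar>r - ys ! p\<bar>"
proof -
  let ?S = "{..<length xs}"
  have "l1_dist (xs[p := r]) ys = \<bar>r - ys ! p\<bar> + (\<Sum>i\<in>?S - {p}. \<bar>xs[p := r] ! i - ys ! i\<bar>)"
    using assms by (simp add: l1_dist_def sum.remove[of ?S p])
  also have "(\<Sum>i\<in>?S - {p}. \<bar>xs[p := r] ! i - ys ! i\<bar>) = (\<Sum>i\<in>?S - {p}. \<bar>xs ! i - ys ! i\<bar>)"
    by (intro sum.cong) auto
  also have "\<dots> = l1_dist xs ys - \<bar>xs ! p - ys ! p\<bar>"
    using assms by (simp add: l1_dist_def sum.remove[of ?S p])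
  finally show ?thesis by simp
qed

text \<open>Potential step for the predicted path: its distance to \<open>E\<close> pays for a
  request at an entry of \<open>E\<close> predicted for the matching server.\<close>

lemma move_cost_serve_target:
  assumes "sorted F" "sorted E" "length F = length E" "p < length E" "r = E ! p"
  shows "\<bar>F ! p - r\<bar> + move_cost (F[p := r]) E \<le> move_cost F E"
proof -
  have "move_cost (F[p := r]) E \<le> l1_dist (F[p := r]) E"
    using assms by (intro move_cost_le_l1) auto
  then show ?thesis
    using assms by (simp add: l1_dist_update move_cost_sorted)
qed

text \<open>Here the configuration in the potential moves too: its first server jumps to the same
  request, and the length of that jump is all that has to be added.\<close>

lemma move_cost_serve_first:
  assumes "sorted F" "sorted (s # hs)" "length F = Suc (length hs)"
  shows "\<bar>F ! 0 - s'\<bar> + move_cost (F[0 := s']) (s' # hs) \<le> move_cost F (s # hs) + \<bar>s - s'\<bar>"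
proof -
  have "move_cost (F[0 := s']) (s' # hs) \<le> l1_dist (F[0 := s']) (s' # hs)"
    using assms by (intro move_cost_le_l1) auto
  also have "\<dots> = move_cost F (s # hs) - \<bar>F ! 0 - s\<bar>"
    using assms by (cases F) (simp_all add: move_cost_sorted)
  finally show ?thesis by linarith
qed

lemma move_cost_Cons_same: "move_cost (s # hs) (s' # hs) \<le> \<bar>s - s'\<bar>"
proof -
  have "l1_dist hs hs = 0" by (simp add: l1_dist_def)
  then show ?thesis using move_cost_le_l1[of "s # hs" "s' # hs"] by simp
qed

section \<open>Runs as sequences\<close>

lemma upt_Suc_shift: "[0..<Suc n] = 0 # map Suc [0..<n]"
  by (simp add: map_Suc_upt upt_conv_Cons del: upt_Suc)

lemma path_cost_nonneg: "0 \<le> path_cost Cs"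
proof -
  have "0 \<le> path_cost_on I Cs" for I
    by (induction I Cs rule: path_cost_on.induct)
      (auto simp: move_cost_on_def intro!: add_nonneg_nonneg sum_nonneg)
  then show ?thesis by (simp add: path_cost_def)
qed

lemma OPT_between:
  assumes "length Ds = length rs"
    and "\<And>t. t < length rs \<Longrightarrow> length (Ds ! t) = length C \<and> rs ! t \<in> set (Ds ! t)"
  shows "0 \<le> OPT C rs \<and> OPT C rs \<le> path_cost (C # Ds)"
proof -
  let ?P = "{path_cost (C # Ds) | Ds. length Ds = length rs \<and>
      (\<forall>t<length rs. length (Ds ! t) = length C \<and> rs ! t \<in> set (Ds ! t))}"
  have ge: "\<And>x. x \<in> ?P \<Longrightarrow> 0 \<le> x" using path_cost_nonneg by auto
  moreover have mem: "path_cost (C # Ds) \<in> ?P" using assms by blast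
  moreover have "bdd_below ?P" using ge by (meson bdd_belowI)
  ultimately show ?thesis unfolding OPT_def
    by (intro conjI cInf_greatest cInf_lower) auto
qed

lemma alg_run_sequence:
  assumes "\<And>n. c (Suc n) = A (c n) (r n) (p n)" and "m \<le> n"
  shows "alg_run A (c m) (map r [m..<n]) (map p [m..<n]) = map c [m..<Suc n]"
  using assms(2)
proof (induction rule: inc_induct)
  case (step i)
  then have "[i..<n] = i # [Suc i..<n]" "[i..<Suc n] = i # [Suc i..<Suc n]"
    by (auto simp: upt_conv_Cons)
  then show ?case using step assms(1) by (simp del: upt_Suc)
qed (simp add: upt_conv_Cons)

lemma path_cost_on_sequence:
  assumes "m \<le> n"
  shows "path_cost_on I (map c [m..<Suc n]) = (\<Sum>i=m..<n. move_cost_on I (c i) (c (Suc i)))"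
  using assms
proof (induction rule: inc_induct)
  case (step i)
  then have eq: "[i..<Suc n] = i # Suc i # [Suc (Suc i)..<Suc n]" "[Suc i..<Suc n] = Suc i # [Suc (Suc i)..<Suc n]"
    by (auto simp: upt_conv_Cons)
  from step show ?case unfolding eq by (simp add: sum.atLeast_Suc_lessThan)
qed (simp add: upt_conv_Cons)

section \<open>The predicted path as a sequence of configurations\<close>

primrec ftp_conf :: "config \<Rightarrow> (nat \<Rightarrow> real) \<Rightarrow> (nat \<Rightarrow> nat) \<Rightarrow> nat \<Rightarrow> config" where
  "ftp_conf C q u 0 = sort C"
| "ftp_conf C q u (Suc n) = sort ((ftp_conf C q u n)[u n - 1 := q n])"

definition ftp_sum :: "config \<Rightarrow> (nat \<Rightarrow> real) \<Rightarrow> (nat \<Rightarrow> nat) \<Rightarrow> nat \<Rightarrow> real" where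
  "ftp_sum C q u n = (\<Sum>i<n. \<bar>ftp_conf C q u i ! (u i - 1) - q i\<bar>)"

lemma sorted_ftp_conf [simp]: "sorted (ftp_conf C q u n)"
  by (cases n) auto

lemma length_ftp_conf [simp]: "length (ftp_conf C q u n) = length C"
  by (induction n) auto

lemma ftp_cost_sort: "ftp_cost (sort C) rs ps = ftp_cost C rs ps"
  by (cases rs; cases ps) (auto simp: sorted_sort_id)

lemma ftp_cost_sequence:
  "ftp_cost C (map q [0..<n]) (map u [0..<n]) = ftp_sum C q u n"
proof -
  have "ftp_cost (ftp_conf C q u m) (map q [m..<n]) (map u [m..<n])
        = (\<Sum>i=m..<n. \<bar>ftp_conf C q u i ! (u i - 1) - q i\<bar>)" if "m \<le> n" for m
    using that
  proof (induction rule: inc_induct)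
    case (step i)
    then have "[i..<n] = i # [Suc i..<n]" by (auto simp: upt_conv_Cons)
    then show ?case using step by (simp add: sorted_sort_id sum.atLeast_Suc_lessThan)
  qed simp
  from this[of 0] show ?thesis
    by (simp add: ftp_cost_sort ftp_sum_def atLeast0LessThan)
qed

text \<open>Telescoped form of \<open>move_cost_serve_target\<close>.\<close>

lemma ftp_sum_target:
  assumes "sorted H" "length H = length C" "m \<le> n"
    and "\<And>i. m \<le> i \<Longrightarrow> i < n \<Longrightarrow> 1 \<le> u i \<and> u i \<le> length C \<and> q i = H ! (u i - 1)"
  shows "ftp_sum C q u n + move_cost (ftp_conf C q u n) H
         \<le> ftp_sum C q u m + move_cost (ftp_conf C q u m) H"
  using assms(3,4)
proof (induction n rule: dec_induct)
  case (step n)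
  have u: "1 \<le> u n \<and> u n \<le> length C \<and> q n = H ! (u n - 1)" using step by simp
  then have "u n - 1 < length H" using assms(2) by linarith
  with u have "\<bar>ftp_conf C q u n ! (u n - 1) - q n\<bar> + move_cost (ftp_conf C q u (Suc n)) H
        \<le> move_cost (ftp_conf C q u n) H"
    using move_cost_serve_target[of "ftp_conf C q u n" H "u n - 1" "q n"] assms(1,2) by simp
  with step show ?case by (simp add: ftp_sum_def)
qed simp

text \<open>\<open>ARG_MIN\<close> leaves open which minimiser it returns, but for a point left of a
  sorted list the minimiser is unique.\<close>

lemma closest_hd:
  assumes "sorted xs" "xs \<noteq> []" "r \<le> hd xs"
  shows "closest xs r = hd xs"
proof -
  have le: "hd xs \<le> x" if "x \<in> set xs" for x
    using assms that by (cases xs) auto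
  have mem: "hd xs \<in> set xs" using assms by simp
  have "is_arg_min (\<lambda>x. \<bar>x - r\<bar>) (\<lambda>x. x \<in> set xs) (closest xs r)"
    unfolding closest_def arg_min_def
  proof (rule someI)
    show "is_arg_min (\<lambda>x. \<bar>x - r\<bar>) (\<lambda>x. x \<in> set xs) (hd xs)"
      using le mem assms(3) by (force simp: is_arg_min_def)
  qed
  then have "closest xs r \<in> set xs" "\<not> \<bar>hd xs - r\<bar> < \<bar>closest xs r - r\<bar>"
    using mem by (auto simp: is_arg_min_def)
  then show ?thesis using le[of "closest xs r"] assms(3) by linarith
qed


section \<open>Consequences of local consistency\<close>

text \<open>Each step gains at least one, which bounds \<open>g i\<close> from below starting at 0
  and from above starting at \<open>k - 1\<close>.\<close>

lemma strict_mono_below_id: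
  fixes g :: "nat \<Rightarrow> nat"
  assumes mono: "\<And>i j. i < j \<Longrightarrow> j < k \<Longrightarrow> g i < g j" and bound: "\<And>i. i < k \<Longrightarrow> g i < k" and "i < k"
  shows "g i = i"
proof -
  have shift: "i + d < k \<Longrightarrow> g i + d \<le> g (i + d)" for i d
  proof (induction d)
    case (Suc d)
    then show ?case using mono[of "i + d" "i + Suc d"] by simp
  qed simp
  have "g i + (k - 1 - i) \<le> g (k - 1)" using shift[of i "k - 1 - i"] \<open>i < k\<close> by simp
  moreover have "g (k - 1) < k" using bound \<open>i < k\<close> by simp
  moreover have "i \<le> g i" using shift[of 0 i] \<open>i < k\<close> by simp
  ultimately show ?thesis using \<open>i < k\<close> by linarith
qed

lemma rho_nonneg: "0 < lam \<Longrightarrow> 0 \<le> rho lam k"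
  by (simp add: rho_def sum_nonneg)

text \<open>Tailored to suffix windows: no prediction lies beyond such a window on the right, so
  only lower labels are redirected. The labels in \<open>p\<close> count from 1, hence the strict
  comparison.\<close>

definition win_req :: "(nat \<Rightarrow> config) \<Rightarrow> (nat \<Rightarrow> real) \<Rightarrow> (nat \<Rightarrow> nat) \<Rightarrow> nat \<Rightarrow> nat \<Rightarrow> real" where
  "win_req c r p j m = (if j < p m then r m else closest (drop j (c (Suc m))) (r m))"

definition win_pred :: "(nat \<Rightarrow> nat) \<Rightarrow> nat \<Rightarrow> nat \<Rightarrow> nat" where
  "win_pred p j m = (if p m \<le> j then 1 else p m - j)"

definition play :: "alg \<Rightarrow> nat \<Rightarrow> (nat \<Rightarrow> config) \<Rightarrow> (nat \<Rightarrow> real) \<Rightarrow> (nat \<Rightarrow> nat) \<Rightarrow> bool" where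
  "play A k c r p \<longleftrightarrow> valid_config k (c 0) \<and>
     (\<forall>n. c (Suc n) = A (c n) (r n) (p n) \<and> 1 \<le> p n \<and> p n \<le> k)"

locale consistent_alg =
  fixes lam :: real and A :: alg and K :: real and f :: "config \<Rightarrow> real"
  assumes lam_pos: "0 < lam" and valid: "valid_alg A" and K_nonneg: "0 \<le> K"
    and loc: "\<And>k C rs ps j k'. valid_instance k C rs ps \<Longrightarrow> 1 \<le> k' \<Longrightarrow> j + k' \<le> k \<Longrightarrow>
       path_cost_on {j..<j+k'} (alg_run A C rs ps)
         \<le> rho lam k' * ftp_cost (take k' (drop j C)) (local_req A C rs ps j k') (local_pred ps j k')
           + min (f C) (K * real k' * move_cost C (last (alg_run A C rs ps)))"
begin

lemma play_valid:
  assumes "play A k c r p"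
  shows "valid_config k (c n)"
proof (induction n)
  case (Suc n)
  then show ?case
    using assms valid by (auto simp: play_def valid_alg_def valid_config_def)
qed (use assms in \<open>simp add: play_def\<close>)

lemma play_length: "play A k c r p \<Longrightarrow> length (c n) = k"
  and play_sorted: "play A k c r p \<Longrightarrow> sorted (c n)"
  using play_valid by (auto simp: valid_config_def)

lemma play_served:
  assumes "play A k c r p"
  shows "r n \<in> set (c (Suc n))"
  using assms valid play_length[OF assms, of n] play_sorted[OF assms, of n]
  by (auto simp: play_def valid_alg_def)

lemma play_run:
  assumes "play A k c r p"
  shows "alg_run A (c 0) (map r [0..<n]) (map p [0..<n]) = map c [0..<Suc n]"
  using assms alg_run_sequence[of c A r p 0 n] by (simp add: play_def del: upt_Suc)

lemma play_instance:
  assumes "play A k c r p"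
  shows "valid_instance k (c 0) (map r [0..<n]) (map p [0..<n])"
  using assms by (auto simp: play_def valid_instance_def valid_preds_def)

lemma window_bound:
  assumes play: "play A k c r p" and "j < k"
  shows "(\<Sum>m<n. move_cost_on {j..<k} (c m) (c (Suc m)))
    \<le> rho lam (k - j) * ftp_sum (drop j (c 0)) (win_req c r p j) (win_pred p j) n
      + min (f (c 0)) (K * real (k - j) * move_cost (c 0) (c n))"
proof -
  have pk: "p m \<le> k" for m using play by (simp add: play_def)
  have "local_req A (c 0) (map r [0..<n]) (map p [0..<n]) j (k - j) = map (win_req c r p j) [0..<n]"
    using \<open>j < k\<close> pk play_length[OF play] play_sorted[OF play]
    by (auto simp: local_req_def win_req_def play_run[OF play] sorted_sort_id nth_append simp del: upt_Suc)
  moreover have "local_pred (map p [0..<n]) j (k - j) = map (win_pred p j) [0..<n]"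
    using \<open>j < k\<close> by (auto simp: local_pred_def win_pred_def leD[OF pk])
  moreover have "take (k - j) (drop j (c 0)) = drop j (c 0)"
    using play_length[OF play] by simp
  moreover have "path_cost_on {j..<k} (map c [0..<Suc n]) = (\<Sum>m<n. move_cost_on {j..<k} (c m) (c (Suc m)))"
    by (simp add: path_cost_on_sequence atLeast0LessThan del: upt_Suc)
  moreover have "last (map c [0..<Suc n]) = c n" by simp
  ultimately show ?thesis
    using loc[OF play_instance[OF play, of n], of "k - j" j] \<open>j < k\<close>
    by (simp add: play_run[OF play] ftp_cost_sequence del: upt_Suc)
qed

lemma full_bound:
  assumes play: "play A k c r p" and "1 \<le> k"
  shows "(\<Sum>m<n. move_cost (c m) (c (Suc m)))
    \<le> rho lam k * ftp_sum (c 0) r p n + min (f (c 0)) (K * real k * move_cost (c 0) (c n))"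
proof -
  have "0 < p m" for m using play by (simp add: play_def Suc_le_eq)
  then have "win_req c r p 0 = r" "win_pred p 0 = p"
    by (simp_all add: fun_eq_iff win_req_def win_pred_def)
  moreover have "move_cost (c m) (c (Suc m)) = move_cost_on {0..<k} (c m) (c (Suc m))" for m
    by (simp add: move_cost_def play_length[OF play] atLeast0LessThan)
  ultimately show ?thesis
    using window_bound[OF play, of 0 n] \<open>1 \<le> k\<close> by simp
qed

lemma play_drift:
  assumes play: "play A k c r p" and "m \<le> n" "i < k"
  shows "\<bar>c n ! i - c m ! i\<bar> \<le> (\<Sum>t=m..<n. move_cost (c t) (c (Suc t)))"
  using assms(2)
proof (induction n rule: dec_induct)
  case (step n)
  have "\<bar>c n ! i - c (Suc n) ! i\<bar> \<le> (\<Sum>i<k. \<bar>c n ! i - c (Suc n) ! i\<bar>)"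
    using \<open>i < k\<close> by (intro member_le_sum) auto
  also have "\<dots> = move_cost (c n) (c (Suc n))"
    using play_length[OF play] play_sorted[OF play] by (simp add: move_cost_sorted l1_dist_def)
  finally show ?case using step by simp
qed simp

text \<open>A round trip costs nothing additive: after the detour, requests next to the points of the
  initial configuration are free for the predictions, so the algorithm converges back to (a
  neighbourhood of) its start, where the additive term vanishes.\<close>

lemma detour_bound:
  assumes play: "play A k c r p" and k: "1 \<le> k" and H: "sorted H" "length H = k"
    and req: "\<And>i. i < n \<Longrightarrow> r i = H ! (p i - 1)"
  shows "(\<Sum>i<n. move_cost (c i) (c (Suc i))) \<le> 2 * rho lam k * move_cost (c 0) H"
proof (rule field_le_epsilon)
  fix e :: real assume "0 < e"
  let ?C = "c 0" and ?\<rho> = "rho lam k"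
  have \<rho>0: "0 \<le> ?\<rho>" using lam_pos by (rule rho_nonneg)
  \<comment> \<open>\<open>M - 1\<close> collects the coefficients of \<delta> in the error terms
    below, so that together they stay below \<open>e\<close>.\<close>
  define M where "M = ?\<rho> * real k ^ 2 + K * real k * (2 * real k ^ 2) + 1"
  have M: "0 < M" using \<rho>0 K_nonneg by (simp add: M_def add_nonneg_pos)
  define \<delta> where "\<delta> = e / M"
  have \<delta>: "0 < \<delta>" using \<open>0 < e\<close> M by (simp add: \<delta>_def)
  have lenC: "length ?C = k" and sC: "sorted ?C"
    using play_length[OF play] play_sorted[OF play] by auto
  \<comment> \<open>Servers may coincide at the start, and a single one could then serve all
    requests at the common point. Spreading the points by multiples of \<delta> prevents
    this.\<close>
  define C' where "C' = map (\<lambda>i. ?C ! i + \<delta> * real i) [0..<k]"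
  have lenC': "length C' = k" by (simp add: C'_def)
  have gap: "C' ! i + \<delta> \<le> C' ! j" if "i < j" "j < k" for i j
  proof -
    have "?C ! i \<le> ?C ! j" using sC lenC that by (auto simp: sorted_nth_mono)
    moreover have "\<delta> * real i + \<delta> \<le> \<delta> * real j"
    proof -
      have "\<delta> * (real i + 1) \<le> \<delta> * real j" using \<delta> that by (intro mult_left_mono) auto
      then show ?thesis by (simp add: algebra_simps)
    qed
    ultimately show ?thesis using that by (simp add: C'_def)
  qed
  have sC': "sorted C'" unfolding sorted_iff_nth_mono_less
    using gap \<delta> lenC' by (smt (verit))
  have CC': "move_cost ?C C' \<le> \<delta> * real k ^ 2"
  proof -
    have "move_cost ?C C' = (\<Sum>i<k. \<delta> * real i)"
      unfolding move_cost_sorted[OF sC sC'] l1_dist_def using \<delta> by (simp add: lenC C'_def)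
    also have "\<dots> \<le> (\<Sum>i<k. \<delta> * real k)" using \<delta> by (intro sum_mono mult_left_mono) auto
    finally show ?thesis by (simp add: power2_eq_square algebra_simps)
  qed
  \<comment> \<open>After the detour the points of \<open>C'\<close> are requested round robin, each
    predicted for its own server.\<close>
  define r' where "r' i = (if i < n then r i else C' ! ((i - n) mod k))" for i
  define p' where "p' i = (if i < n then p i else Suc ((i - n) mod k))" for i
  define c' where "c' = rec_nat ?C (\<lambda>i s. A s (r' i) (p' i))"
  have c'_Suc: "c' (Suc i) = A (c' i) (r' i) (p' i)" for i by (simp add: c'_def)
  have c'_0: "c' 0 = ?C" by (simp add: c'_def)
  have p'_le: "1 \<le> p' i \<and> p' i \<le> k" for i
    using play k by (auto simp: p'_def play_def Suc_le_eq)
  have play': "play A k c' r' p'"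
    using play c'_Suc c'_0 p'_le by (simp add: play_def)
  have c'_eq: "c' i = c i" if "i \<le> n" for i
    using that
  proof (induction i)
    case (Suc i)
    then show ?case using play by (simp add: c'_Suc r'_def p'_def play_def)
  qed (simp add: c'_0)
  let ?x = "\<lambda>i. move_cost (c' i) (c' (Suc i))"
  have x0: "0 \<le> ?x i" for i by (rule move_cost_nonneg)
  \<comment> \<open>The predicted path pays at most the distance from the start to \<open>H\<close>
    and from \<open>H\<close> to \<open>C'\<close>, however many rounds follow.\<close>
  have ftp: "ftp_sum ?C r' p' N \<le> 2 * move_cost ?C H + \<delta> * real k ^ 2" if "n \<le> N" for N
  proof -
    have "r' i = H ! (p' i - 1)" if "i < n" for i using req that by (simp add: r'_def p'_def)
    then have 1: "ftp_sum ?C r' p' n + move_cost (ftp_conf ?C r' p' n) H \<le> move_cost ?C H"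
      using ftp_sum_target[of H ?C 0 n p' r'] H lenC p'_le by (simp add: ftp_sum_def[of _ _ _ 0])
    have 2: "ftp_sum ?C r' p' N + move_cost (ftp_conf ?C r' p' N) C'
      \<le> ftp_sum ?C r' p' n + move_cost (ftp_conf ?C r' p' n) C'"
    proof (intro ftp_sum_target conjI)
      fix i assume "n \<le> i"
      then show "r' i = C' ! (p' i - 1)" by (simp add: r'_def p'_def)
    qed (use p'_le lenC lenC' that in \<open>auto simp: sC'\<close>)
    have "move_cost (ftp_conf ?C r' p' n) C' \<le> move_cost (ftp_conf ?C r' p' n) H + move_cost H C'"
      using H lenC by (intro move_cost_triangle) simp
    moreover have "move_cost H C' \<le> move_cost H ?C + move_cost ?C C'"
      using H lenC by (intro move_cost_triangle) simp
    moreover have "move_cost H ?C = move_cost ?C H" using H lenC by (intro move_cost_commute) simp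
    moreover have "0 \<le> move_cost (ftp_conf ?C r' p' N) C'" by (rule move_cost_nonneg)
    ultimately show ?thesis using 1 2 CC' by linarith
  qed
  have bound: "(\<Sum>i<N. ?x i) \<le> ?\<rho> * (2 * move_cost ?C H + \<delta> * real k ^ 2)
      + min (f ?C) (K * real k * move_cost ?C (c' N))" if "n \<le> N" for N
    using full_bound[OF play' k, of N] mult_left_mono[OF ftp[OF that] \<rho>0] by (simp add: c'_0)
  define B where "B = ?\<rho> * (2 * move_cost ?C H + \<delta> * real k ^ 2) + f ?C"
  have B: "(\<Sum>i<N. ?x i) \<le> B" if "n \<le> N" for N
    using bound[OF that] by (simp add: B_def min_def split: if_splits)
  define \<epsilon> where "\<epsilon> = \<delta> / 4"
  have \<epsilon>: "0 < \<epsilon>" using \<delta> by (simp add: \<epsilon>_def)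
  \<comment> \<open>The total cost stays below \<open>B\<close> forever, so not every round can cost
    more than \<epsilon>.\<close>
  obtain m where m: "(\<Sum>i=n + m * k..<n + Suc m * k. ?x i) \<le> \<epsilon>"
  proof (rule ccontr)
    assume "\<not> thesis"
    then have *: "\<epsilon> < (\<Sum>i=n + m * k..<n + Suc m * k. ?x i)" for m
      using that by (meson not_le)
    have "real m * \<epsilon> \<le> (\<Sum>i<n + m * k. ?x i)" for m
    proof (induction m)
      case (Suc m)
      have "(\<Sum>i<n + Suc m * k. ?x i) = (\<Sum>i<n + m * k. ?x i) + (\<Sum>i=n + m * k..<n + Suc m * k. ?x i)"
        unfolding lessThan_atLeast0 by (rule sum.atLeastLessThan_concat[symmetric]) auto
      then show ?case using Suc *[of m] by (simp add: algebra_simps)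
    qed (simp add: sum_nonneg x0)
    then have "real m * \<epsilon> \<le> B" for m using B[of "n + m * k"] by (meson le_add1 order_trans)
    moreover obtain m where "B < real m * \<epsilon>" using reals_Archimedean3[OF \<epsilon>] by blast
    ultimately show False by (meson not_le)
  qed
  define N where "N = n + Suc m * k"
  define S where "S = c' N"
  have lenS: "length S = k" and sS: "sorted S"
    using play_length[OF play'] play_sorted[OF play'] by (auto simp: S_def)
  \<comment> \<open>In the cheap round every point of \<open>C'\<close> is served, and the serving
    server strays at most \<epsilon> until the round ends.\<close>
  have "\<exists>j<k. \<bar>S ! j - C' ! i\<bar> \<le> \<epsilon>" if "i < k" for i
  proof -
    define t where "t = n + m * k + i"
    have "r' t = C' ! i" using that by (simp add: r'_def t_def)
    then have "C' ! i \<in> set (c' (Suc t))" using play_served[OF play', of t] by simp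
    then obtain j where j: "j < k" "c' (Suc t) ! j = C' ! i"
      using play_length[OF play'] by (auto simp: in_set_conv_nth)
    have tN: "Suc t \<le> N" using that by (simp add: t_def N_def)
    have "\<bar>S ! j - c' (Suc t) ! j\<bar> \<le> (\<Sum>i=Suc t..<N. ?x i)"
      using play_drift[OF play' tN j(1)] by (simp add: S_def)
    also have "\<dots> \<le> (\<Sum>i=n + m * k..<N. ?x i)"
      by (intro sum_mono2) (auto simp: x0 t_def)
    finally show ?thesis using m j by (auto simp: N_def)
  qed
  then obtain g where g: "\<And>i. i < k \<Longrightarrow> g i < k \<and> \<bar>S ! g i - C' ! i\<bar> \<le> \<epsilon>" by metis
  \<comment> \<open>The points are at least 4 \<epsilon> apart, so the assignment preserves the
    order.\<close>
  have "g i = i" if "i < k" for i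
  proof (rule strict_mono_below_id[of k g])
    fix i j :: nat assume ij: "i < j" "j < k"
    then have "\<bar>S ! g i - C' ! i\<bar> \<le> \<delta> / 4" "\<bar>S ! g j - C' ! j\<bar> \<le> \<delta> / 4"
      using g by (auto simp: \<epsilon>_def)
    then have "S ! g i < S ! g j" using gap[OF ij] \<delta> by linarith
    then show "g i < g j"
      using sS lenS g[of i] ij by (metis leI less_trans not_le sorted_nth_mono)
  qed (use g that in auto)
  then have SC': "\<bar>C' ! i - S ! i\<bar> \<le> \<epsilon>" if "i < k" for i
    using g[OF that] that by (simp add: abs_minus_commute)
  have "move_cost C' S \<le> real k * \<epsilon>"
    using sum_bounded_above[of "{..<k}" "\<lambda>i. \<bar>C' ! i - S ! i\<bar>" \<epsilon>] SC'
    by (simp add: move_cost_sorted sC' sS l1_dist_def lenC')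
  also have "\<dots> \<le> \<delta> * real k ^ 2"
  proof -
    have "real k * \<epsilon> \<le> real k * \<delta>" using \<delta> by (intro mult_left_mono) (auto simp: \<epsilon>_def)
    also have "\<dots> \<le> real k * (\<delta> * real k)" using \<delta> k by (intro mult_left_mono) auto
    finally show ?thesis by (simp add: power2_eq_square algebra_simps)
  qed
  finally have "move_cost ?C S \<le> 2 * (\<delta> * real k ^ 2)"
    using move_cost_triangle[of ?C C' S] CC' lenC lenC' by simp
  then have "K * real k * move_cost ?C S \<le> K * real k * (2 * (\<delta> * real k ^ 2))"
    using K_nonneg by (intro mult_left_mono) auto
  moreover have "(\<Sum>i<N. ?x i) \<le> ?\<rho> * (2 * move_cost ?C H + \<delta> * real k ^ 2) + K * real k * move_cost ?C S"
    using bound[of N] by (simp add: N_def S_def)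
  moreover have "(\<Sum>i<n. move_cost (c i) (c (Suc i))) = (\<Sum>i<n. ?x i)"
    by (intro sum.cong) (auto simp: c'_eq)
  moreover have "(\<Sum>i<n. ?x i) \<le> (\<Sum>i<N. ?x i)"
    by (intro sum_mono2) (auto simp: x0 N_def)
  moreover have "?\<rho> * (\<delta> * real k ^ 2) + K * real k * (2 * (\<delta> * real k ^ 2)) \<le> e"
  proof -
    have "?\<rho> * (\<delta> * real k ^ 2) + K * real k * (2 * (\<delta> * real k ^ 2)) = \<delta> * (M - 1)"
      by (simp add: M_def algebra_simps)
    also have "\<dots> \<le> \<delta> * M" using \<delta> by (intro mult_left_mono) auto
    also have "\<dots> = e" using M by (simp add: \<delta>_def)
    finally show ?thesis .
  qed
  ultimately show "(\<Sum>i<n. move_cost (c i) (c (Suc i))) \<le> 2 * ?\<rho> * move_cost ?C H + e"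
    by (simp add: algebra_simps)
qed

lemma detour_bound_interval:
  assumes play: "play A k c r p" and "1 \<le> k" "sorted H" "length H = k" "m \<le> n"
    and req: "\<And>i. m \<le> i \<Longrightarrow> i < n \<Longrightarrow> r i = H ! (p i - 1)"
  shows "(\<Sum>i=m..<n. move_cost (c i) (c (Suc i))) \<le> 2 * rho lam k * move_cost (c m) H"
proof -
  have "play A k (\<lambda>i. c (i + m)) (\<lambda>i. r (i + m)) (\<lambda>i. p (i + m))"
    using play play_valid[OF play, of m] by (simp add: play_def)
  from detour_bound[OF this, of H "n - m"] assms
  have "(\<Sum>i<n - m. move_cost (c (i + m)) (c (Suc i + m))) \<le> 2 * rho lam k * move_cost (c m) H"
    by simp
  moreover have "(\<Sum>i=m..<n. move_cost (c i) (c (Suc i)))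
      = (\<Sum>i<n - m. move_cost (c (i + m)) (c (Suc i + m)))"
    using sum.shift_bounds_nat_ivl[of "\<lambda>i. move_cost (c i) (c (Suc i))" 0 m "n - m"] \<open>m \<le> n\<close>
    by (simp add: atLeast0LessThan)
  ultimately show ?thesis by simp
qed

end

section \<open>The adversary\<close>

locale adversary = consistent_alg +
  fixes k :: nat
  assumes two_le_k: "2 \<le> k"
begin

text \<open>Bounds the movement from a calm time up to the next call of the last server: the detour
  factor \<open>2 * rho lam k\<close> times a distance of \<open>3 / 2 * real k\<close>.\<close>

definition drift :: real where
  "drift = 3 * rho lam k * real k"

text \<open>The bracket bounds the distance, at the last calm time, to the configuration requested
  since then. The detour bound multiplies it, and the final 3 / 2 is the offset of a single server
  at that time.\<close>

definition width :: real where
  "width = 2 * rho lam k * (3 / 2 * real k + drift + 1) + 3 / 2"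

text \<open>Keeps the ranges of radius \<open>width\<close> around the targets disjoint even when
  the first target has moved by 1.\<close>

definition spacing :: real where
  "spacing = 2 * width + 3"

text \<open>Normally the home of server \<open>k - 2\<close>. For \<open>k = 2\<close> that server
  is also the one with the alternating target, which must not pass the edge.\<close>

definition edge :: real where
  "edge = (if k = 2 then 1 else real (k - 2) * spacing)"

definition home :: "nat \<Rightarrow> real" where
  "home i = (if i = k - 1 then edge + 1 else real i * spacing)"

definition target :: "real \<Rightarrow> nat \<Rightarrow> real" where
  "target \<tau> i = (if i = 0 then \<tau> else home i)"

text \<open>Returns a label counted from 0, a request and the next position of the first target.
  Server \<open>k - 2\<close> gets no tolerance on the left: while it is short of its target the
  predicted path of the last window may be ahead of it, and then no lower server may be called. The
  tolerance 1 / 2 makes every call of a lower server expensive.\<close>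

definition choice :: "config \<Rightarrow> real \<Rightarrow> nat \<times> real \<times> real" where
  "choice s \<tau> =
    (if s ! (k - 1) \<le> edge then (k - 1, edge + 1, \<tau>)
     else if s ! (k - 2) < target \<tau> (k - 2) \<or> target \<tau> (k - 2) + 1 / 2 < s ! (k - 2)
       then (k - 2, target \<tau> (k - 2), \<tau>)
     else if \<exists>i<k - 2. 1 / 2 < \<bar>s ! i - target \<tau> i\<bar>
       then (let i = (SOME i. i < k - 2 \<and> 1 / 2 < \<bar>s ! i - target \<tau> i\<bar>) in (i, target \<tau> i, \<tau>))
     else (0, 1 - \<tau>, 1 - \<tau>))"

primrec state :: "nat \<Rightarrow> config \<times> real" where
  "state 0 = (map home [0..<k], 0)"
| "state (Suc n) = (let (s, \<tau>) = state n; (l, r, \<tau>') = choice s \<tau> in (A s r (Suc l), \<tau>'))"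

definition conf :: "nat \<Rightarrow> config" where "conf n = fst (state n)"
definition tau :: "nat \<Rightarrow> real" where "tau n = snd (state n)"
definition lab :: "nat \<Rightarrow> nat" where "lab n = fst (choice (conf n) (tau n))"
definition req :: "nat \<Rightarrow> real" where "req n = fst (snd (choice (conf n) (tau n)))"

text \<open>The condition under which \<open>choice\<close> reaches its last branch and flips the
  first target.\<close>

definition calm :: "nat \<Rightarrow> bool" where
  "calm n \<longleftrightarrow> edge < conf n ! (k - 1) \<and> target (tau n) (k - 2) \<le> conf n ! (k - 2)
     \<and> (\<forall>i\<le>k - 2. \<bar>conf n ! i - target (tau n) i\<bar> \<le> 1 / 2)"

lemma conf_Suc: "conf (Suc n) = A (conf n) (req n) (Suc (lab n))"
  by (simp add: conf_def req_def lab_def tau_def case_prod_beta Let_def)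

lemma tau_Suc: "tau (Suc n) = snd (snd (choice (conf n) (tau n)))"
  by (simp add: conf_def tau_def case_prod_beta Let_def)

lemma conf_0: "conf 0 = map home [0..<k]" and tau_0: "tau 0 = 0"
  by (simp_all add: conf_def tau_def)

lemma step_cases [consumes 0, case_names event mid low calm]:
  obtains
    "conf n ! (k - 1) \<le> edge" "lab n = k - 1" "req n = edge + 1" "tau (Suc n) = tau n"
  | "edge < conf n ! (k - 1)"
    "conf n ! (k - 2) < target (tau n) (k - 2) \<or> target (tau n) (k - 2) + 1 / 2 < conf n ! (k - 2)"
    "lab n = k - 2" "req n = target (tau n) (k - 2)" "tau (Suc n) = tau n"
  | "edge < conf n ! (k - 1)"
    "target (tau n) (k - 2) \<le> conf n ! (k - 2)" "conf n ! (k - 2) \<le> target (tau n) (k - 2) + 1 / 2"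
    "lab n < k - 2" "1 / 2 < \<bar>conf n ! lab n - target (tau n) (lab n)\<bar>"
    "req n = target (tau n) (lab n)" "tau (Suc n) = tau n"
  | "calm n" "lab n = 0" "req n = 1 - tau n" "tau (Suc n) = 1 - tau n"
proof -
  let ?s = "conf n" and ?\<tau> = "tau n"
  consider "?s ! (k - 1) \<le> edge"
    | "edge < ?s ! (k - 1)" "?s ! (k - 2) < target ?\<tau> (k - 2) \<or> target ?\<tau> (k - 2) + 1 / 2 < ?s ! (k - 2)"
    | "edge < ?s ! (k - 1)" "\<not> (?s ! (k - 2) < target ?\<tau> (k - 2) \<or> target ?\<tau> (k - 2) + 1 / 2 < ?s ! (k - 2))"
      "\<exists>i<k - 2. 1 / 2 < \<bar>?s ! i - target ?\<tau> i\<bar>"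
    | "edge < ?s ! (k - 1)" "\<not> (?s ! (k - 2) < target ?\<tau> (k - 2) \<or> target ?\<tau> (k - 2) + 1 / 2 < ?s ! (k - 2))"
      "\<not> (\<exists>i<k - 2. 1 / 2 < \<bar>?s ! i - target ?\<tau> i\<bar>)"
    using not_le by blast
  then show thesis
  proof cases
    case 1
    then show ?thesis using that(1) by (simp add: lab_def req_def tau_Suc choice_def)
  next
    case 2
    then show ?thesis using that(2) by (simp add: lab_def req_def tau_Suc choice_def)
  next
    case 3
    define i where "i = (SOME i. i < k - 2 \<and> 1 / 2 < \<bar>?s ! i - target ?\<tau> i\<bar>)"
    have i: "i < k - 2 \<and> 1 / 2 < \<bar>?s ! i - target ?\<tau> i\<bar>"
      unfolding i_def using 3(3) by (rule someI_ex)
    have "choice ?s ?\<tau> = (i, target ?\<tau> i, ?\<tau>)"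
      using 3 unfolding choice_def i_def[symmetric] by (simp only: not_le if_not_P if_P Let_def not_False_eq_True)
    then show ?thesis using that(3) 3 i by (simp add: lab_def req_def tau_Suc)
  next
    case 4
    have "choice ?s ?\<tau> = (0, 1 - ?\<tau>, 1 - ?\<tau>)"
      using 4 unfolding choice_def by (simp only: not_le if_not_P not_False_eq_True)
    moreover have "calm n" unfolding calm_def
    proof (intro conjI allI impI)
      fix i assume "i \<le> k - 2"
      then consider "i = k - 2" | "i < k - 2" by linarith
      then show "\<bar>?s ! i - target ?\<tau> i\<bar> \<le> 1 / 2"
      proof cases
        case 2
        then show ?thesis using 4(3) by (meson not_le)
      qed (use 4 in auto)
    qed (use 4 in auto)
    ultimately show ?thesis using that(4) by (simp add: lab_def req_def tau_Suc)
  qed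
qed

lemma tau_cases: "tau n = 0 \<or> tau n = 1"
proof (induction n)
  case (Suc n)
  then show ?case by (cases n rule: step_cases) auto
qed (simp add: tau_0)

lemma lab_less: "lab n < k"
  using two_le_k by (cases n rule: step_cases) auto

lemma req_target: "lab n < k - 1 \<Longrightarrow> req n = target (tau (Suc n)) (lab n)"
  by (cases n rule: step_cases) (auto simp: target_def)

lemma req_event: "lab n = k - 1 \<Longrightarrow> req n = edge + 1 \<and> conf n ! (k - 1) \<le> edge \<and> tau (Suc n) = tau n"
  using two_le_k by (cases n rule: step_cases) auto

section \<open>Distances between homes and targets\<close>

lemma rho_k: "0 \<le> rho lam k"
  using lam_pos by (rule rho_nonneg)

lemma drift_nonneg: "0 \<le> drift"
  using rho_k by (simp add: drift_def)

lemma width_ge: "3 / 2 \<le> width"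
  using rho_k drift_nonneg by (simp add: width_def)

lemma spacing_ge: "6 \<le> spacing"
  using width_ge by (simp add: spacing_def)

lemma home_gap:
  assumes "i < j" "j \<le> k - 2"
  shows "home i + spacing \<le> home j"
proof -
  have "(real i + 1) * spacing \<le> real j * spacing"
    using assms spacing_ge by (intro mult_right_mono) auto
  moreover have "i \<noteq> k - 1" "j \<noteq> k - 1" using assms two_le_k by linarith+
  ultimately show ?thesis by (simp add: home_def algebra_simps)
qed

lemma home_last: "home (k - 1) = edge + 1"
  by (simp add: home_def)

lemma home_0: "home 0 = 0"
  using two_le_k by (simp add: home_def)

lemma home_le_edge:
  assumes "i \<le> k - 2"
  shows "home i \<le> edge"
proof (cases "k = 2")
  case True
  then have "i = 0" using assms by simp
  moreover have "edge = 1" using True unfolding edge_def by simp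
  ultimately show ?thesis using home_0 by simp
next
  case False
  have "real i * spacing \<le> real (k - 2) * spacing"
    using assms spacing_ge by (intro mult_right_mono) auto
  then show ?thesis using False assms two_le_k by (auto simp: home_def edge_def)
qed

lemma home_mono:
  assumes "i < j" "j < k"
  shows "home i \<le> home j"
proof (cases "j = k - 1")
  case True
  then have "home i \<le> edge" using assms by (intro home_le_edge) linarith
  then show ?thesis using True home_last by simp
next
  case False
  then have "home i + spacing \<le> home j" using assms by (intro home_gap) linarith+
  then show ?thesis using spacing_ge by linarith
qed

lemma target_gap:
  assumes "i < j" "j \<le> k - 2" "\<tau> = 0 \<or> \<tau> = 1"
  shows "target \<tau> i + (2 * width + 2) \<le> target \<tau> j"
  using home_gap[OF assms(1,2)] assms home_0 spacing_def by (auto simp: target_def)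

lemma target_le_edge:
  assumes "i \<le> k - 2" "\<tau> = 0 \<or> \<tau> = 1"
  shows "target \<tau> i \<le> edge"
proof (cases "k = 2")
  case True
  then have "i = 0" using assms by simp
  moreover have "edge = 1" using True unfolding edge_def by simp
  ultimately show ?thesis using assms by (auto simp: target_def)
next
  case False
  then have "home 0 + spacing \<le> home (k - 2)" using two_le_k by (intro home_gap) auto
  then show ?thesis
    using home_le_edge[of i] home_le_edge[of "k - 2"] assms spacing_ge home_0 by (auto simp: target_def)
qed

lemma play_conf: "play A k conf req (\<lambda>n. Suc (lab n))"
proof -
  have "sorted (map home [0..<k])"
    unfolding sorted_iff_nth_mono_less using home_mono by auto
  then show ?thesis
    using lab_less by (simp add: play_def valid_config_def conf_0 conf_Suc Suc_le_eq)
qed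

lemma length_conf [simp]: "length (conf n) = k"
  and sorted_conf [simp]: "sorted (conf n)"
  and served: "req n \<in> set (conf (Suc n))"
  using play_length[OF play_conf] play_sorted[OF play_conf] play_served[OF play_conf] by auto

lemma conf_mono: "i \<le> j \<Longrightarrow> j < k \<Longrightarrow> conf n ! i \<le> conf n ! j"
  using sorted_conf length_conf by (simp add: sorted_nth_mono)

lemma calm_0: "calm 0"
proof -
  have "conf 0 ! i = target (tau 0) i" if "i \<le> k - 2" for i
    using that two_le_k home_0 by (simp add: conf_0 tau_0 target_def)
  moreover have "conf 0 ! (k - 1) = edge + 1" using two_le_k home_last by (simp add: conf_0)
  ultimately show ?thesis by (simp add: calm_def)
qed

lemma last_calm:
  assumes "0 < n"
  shows "\<exists>m<n. calm m \<and> (\<forall>i. m < i \<and> i < n \<longrightarrow> \<not> calm i)"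
  using assms
proof (induction n)
  case (Suc n)
  show ?case
  proof (cases "calm n")
    case False
    then have "0 < n" using calm_0 by (cases n) auto
    then obtain m where "m < n" "calm m" "\<forall>i. m < i \<and> i < n \<longrightarrow> \<not> calm i" using Suc.IH by blast
    then show ?thesis using False by (metis less_Suc_eq)
  qed auto
qed simp

text \<open>Since the last calm time all requests have been at one fixed configuration close to the
  configuration at that time, so the detour bound applies to that whole stretch.\<close>

lemma conf_near_target:
  assumes "i \<le> k - 2"
  shows "\<bar>conf n ! i - target (tau n) i\<bar> \<le> width"
proof (cases "n = 0")
  case True
  then show ?thesis using calm_0 assms width_ge by (force simp: calm_def)
next
  case False
  then obtain m where m: "m < n" "calm m" and nc: "\<And>i. m < i \<Longrightarrow> i < n \<Longrightarrow> \<not> calm i"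
    using last_calm[of n] by auto
  define \<tau> where "\<tau> = tau (Suc m)"
  have \<tau>01: "\<tau> = 0 \<or> \<tau> = 1" using tau_cases by (simp add: \<tau>_def)
  have tau_eq: "tau j = \<tau>" if "Suc m \<le> j" "j \<le> n" for j
    using that
  proof (induction j rule: dec_induct)
    case (step j)
    then have "\<not> calm j" using nc by simp
    then show ?case using step by (cases j rule: step_cases) auto
  qed (simp add: \<tau>_def)
  \<comment> \<open>The entry \<open>b\<close> is free: until the last server is called, its own
    position can be inserted; once it is called, \<open>b\<close> must be
    \<open>edge + 1\<close>.\<close>
  define H where "H b = map (\<lambda>i. if i < k - 1 then target \<tau> i else b) [0..<k]" for b
  have H_nth: "H b ! i = (if i < k - 1 then target \<tau> i else b)" if "i < k" for b i
    using that by (simp add: H_def)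
  have H_sorted: "sorted (H b)" if "edge < b \<or> edge + 1 = b" for b
    unfolding sorted_iff_nth_mono_less
  proof (intro allI impI)
    fix i j assume "i < j" "j < length (H b)"
    then have ij: "i < j" "i \<le> k - 2" "i < k - 1" "j < k" by (auto simp: H_def)
    have le: "target \<tau> i \<le> edge" using ij \<tau>01 by (intro target_le_edge)
    show "H b ! i \<le> H b ! j"
    proof (cases "j < k - 1")
      case True
      then have "target \<tau> i + (2 * width + 2) \<le> target \<tau> j"
        using ij \<tau>01 by (intro target_gap) auto
      then show ?thesis using ij True width_ge by (simp add: H_nth)
    next
      case False
      then show ?thesis using ij le that by (auto simp: H_nth)
    qed
  qed
  \<comment> \<open>1 / 2 comes from the calm time, 1 from the flip of the first target.\<close>
  have start: "\<bar>conf m ! i - target \<tau> i\<bar> \<le> 3 / 2" if "i \<le> k - 2" for i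
  proof -
    have "\<bar>conf m ! i - target (tau m) i\<bar> \<le> 1 / 2" using m(2) that by (simp add: calm_def)
    moreover have "\<bar>target (tau m) i - target \<tau> i\<bar> \<le> 1"
      using tau_cases[of m] \<tau>01 by (auto simp: target_def)
    ultimately show ?thesis by linarith
  qed
  have dist: "move_cost (conf m) (H b) \<le> 3 / 2 * real k + \<bar>conf m ! (k - 1) - b\<bar>"
    if "edge < b \<or> edge + 1 = b" for b
  proof -
    have "move_cost (conf m) (H b) = (\<Sum>i<Suc (k - 1). \<bar>conf m ! i - H b ! i\<bar>)"
      using H_sorted[OF that] two_le_k by (simp add: move_cost_sorted l1_dist_def)
    also have "\<dots> = (\<Sum>i<k - 1. \<bar>conf m ! i - target \<tau> i\<bar>) + \<bar>conf m ! (k - 1) - b\<bar>"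
      unfolding sum.lessThan_Suc using two_le_k by (simp add: H_nth)
    also have "(\<Sum>i<k - 1. \<bar>conf m ! i - target \<tau> i\<bar>) \<le> (\<Sum>i<k - 1. 3 / 2)"
      using start by (intro sum_mono) auto
    also have "\<dots> \<le> 3 / 2 * real k" by simp
    finally show ?thesis by simp
  qed
  have reqH: "req j = H b ! lab j" if "m \<le> j" "j < n" "lab j = k - 1 \<Longrightarrow> b = edge + 1" for j b
  proof (cases "lab j = k - 1")
    case True
    then show ?thesis using that two_le_k by (simp add: H_nth req_event)
  next
    case False
    then have "lab j < k - 1" using lab_less[of j] by linarith
    then show ?thesis using req_target[of j] tau_eq[of "Suc j"] that by (simp add: H_nth)
  qed
  have cost: "(\<Sum>i=m..<n'. move_cost (conf i) (conf (Suc i))) \<le> 2 * rho lam k * move_cost (conf m) (H b)"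
    if "m \<le> n'" "n' \<le> n" "edge < b \<or> edge + 1 = b"
      "\<And>j. m \<le> j \<Longrightarrow> j < n' \<Longrightarrow> lab j = k - 1 \<Longrightarrow> b = edge + 1" for n' b
  proof (intro detour_bound_interval[OF play_conf])
    fix i assume "m \<le> i" "i < n'"
    then show "req i = H b ! (Suc (lab i) - 1)" using reqH[of i b] that by simp
  qed (use two_le_k that H_sorted in \<open>auto simp: H_def\<close>)
  have top: "edge < conf m ! (k - 1)" using m(2) by (simp add: calm_def)
  have quiet: "(\<Sum>i=m..<n'. move_cost (conf i) (conf (Suc i))) \<le> drift"
    if "m \<le> n'" "n' \<le> n" "\<And>j. m \<le> j \<Longrightarrow> j < n' \<Longrightarrow> lab j \<noteq> k - 1" for n'
  proof -
    have "(\<Sum>i=m..<n'. move_cost (conf i) (conf (Suc i)))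
        \<le> 2 * rho lam k * move_cost (conf m) (H (conf m ! (k - 1)))"
      using that top by (intro cost) auto
    also have "\<dots> \<le> 2 * rho lam k * (3 / 2 * real k)"
      using dist[of "conf m ! (k - 1)"] top rho_k by (intro mult_left_mono) auto
    finally show ?thesis by (simp add: drift_def mult_ac)
  qed
  have total: "(\<Sum>i=m..<n. move_cost (conf i) (conf (Suc i))) \<le> width - 3 / 2"
  proof (cases "\<exists>j. m \<le> j \<and> j < n \<and> lab j = k - 1")
    case False
    then have "(\<Sum>i=m..<n. move_cost (conf i) (conf (Suc i)))
        \<le> 2 * rho lam k * move_cost (conf m) (H (conf m ! (k - 1)))"
      using m top by (intro cost) auto
    also have "\<dots> \<le> 2 * rho lam k * (3 / 2 * real k + drift + 1)"
      using dist[of "conf m ! (k - 1)"] top rho_k drift_nonneg by (intro mult_left_mono) auto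
    finally show ?thesis by (simp add: width_def)
  next
    case True
    define j where "j = (LEAST j. m \<le> j \<and> j < n \<and> lab j = k - 1)"
    have j: "m \<le> j" "j < n" "lab j = k - 1"
      using LeastI_ex[OF True] by (auto simp: j_def)
    have min: "lab i \<noteq> k - 1" if "m \<le> i" "i < j" for i
      using not_less_Least[of i "\<lambda>j. m \<le> j \<and> j < n \<and> lab j = k - 1"] that j(2) by (auto simp: j_def)
    \<comment> \<open>At this call the last server is at most at \<open>edge\<close>; having moved
      at most \<open>drift\<close>, it must have started near \<open>edge\<close>, no matter where
      an earlier event had sent it.\<close>
    have "\<bar>conf j ! (k - 1) - conf m ! (k - 1)\<bar> \<le> drift"
      using play_drift[OF play_conf j(1), of "k - 1"] quiet[of j] min j two_le_k by fastforce
    then have b: "\<bar>conf m ! (k - 1) - (edge + 1)\<bar> \<le> drift + 1"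
      using req_event[OF j(3)] top drift_nonneg by linarith
    have "(\<Sum>i=m..<n. move_cost (conf i) (conf (Suc i)))
        \<le> 2 * rho lam k * move_cost (conf m) (H (edge + 1))"
      using m by (intro cost) auto
    also have "\<dots> \<le> 2 * rho lam k * (3 / 2 * real k + drift + 1)"
      using dist[of "edge + 1"] b rho_k by (intro mult_left_mono) auto
    finally show ?thesis by (simp add: width_def)
  qed
  have "\<bar>conf n ! i - conf m ! i\<bar> \<le> width - 3 / 2"
    using play_drift[OF play_conf, of m n i] total m(1) assms two_le_k by fastforce
  moreover have "tau n = \<tau>" using tau_eq m(1) by simp
  ultimately show ?thesis using start[OF assms] by (simp only:)
qed

text \<open>Every other server is confined to the surroundings of its own target or stands right of
  server \<open>k - 2\<close>, hence is too far away to serve the request.\<close>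

lemma served_low:
  assumes "lab n < k - 2"
  shows "conf (Suc n) ! lab n = req n"
proof -
  let ?s = "conf (Suc n)" and ?\<tau> = "tau (Suc n)"
  have r: "req n = target ?\<tau> (lab n)" using assms by (intro req_target) simp
  obtain i where i: "i < k" "?s ! i = req n"
    using served[of n] by (auto simp: in_set_conv_nth)
  have far: "\<bar>?s ! j - target ?\<tau> j\<bar> \<le> width" if "j \<le> k - 2" for j
    using that by (rule conf_near_target)
  consider "i = lab n" | "i < lab n" | "lab n < i" "i \<le> k - 2" | "i = k - 1"
    using i(1) by linarith
  then show ?thesis
  proof cases
    case 2
    then show ?thesis using far[of i] target_gap[of i "lab n" ?\<tau>] tau_cases assms i r width_ge by fastforce
  next
    case 3
    then show ?thesis using far[of i] target_gap[of "lab n" i ?\<tau>] tau_cases assms i r width_ge by fastforce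
  next
    case 4
    have "?s ! (k - 2) \<le> ?s ! i" using 4 two_le_k by (intro conf_mono) auto
    then show ?thesis
      using far[of "k - 2"] target_gap[of "lab n" "k - 2" ?\<tau>] tau_cases assms i r width_ge by fastforce
  qed (use i in simp)
qed

text \<open>Only server \<open>k - 1\<close> can step in for server \<open>k - 2\<close>. It has
  then come down to \<open>edge\<close> or below, so an event follows, and server
  \<open>k - 2\<close> is not to its right.\<close>

lemma served_mid:
  assumes "lab n = k - 2"
  shows "conf (Suc n) ! (k - 2) \<le> req n"
    and "conf (Suc n) ! (k - 2) = req n \<or> conf (Suc n) ! (k - 1) \<le> edge"
proof -
  let ?s = "conf (Suc n)" and ?\<tau> = "tau (Suc n)"
  have r: "req n = target ?\<tau> (k - 2)" using assms two_le_k req_target[of n] by simp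
  obtain i where i: "i < k" "?s ! i = req n"
    using served[of n] by (auto simp: in_set_conv_nth)
  have le: "target ?\<tau> (k - 2) \<le> edge" using tau_cases by (intro target_le_edge) auto
  consider "i = k - 2" | "i < k - 2" | "i = k - 1"
    using i(1) by linarith
  then have "?s ! (k - 2) \<le> req n \<and> (?s ! (k - 2) = req n \<or> ?s ! (k - 1) \<le> edge)"
  proof cases
    case 2
    then show ?thesis
      using conf_near_target[of i "Suc n"] target_gap[of i "k - 2" ?\<tau>] tau_cases i r width_ge by fastforce
  next
    case 3
    have "?s ! (k - 2) \<le> ?s ! i" using 3 two_le_k by (intro conf_mono) auto
    then show ?thesis using 3 i r le by auto
  qed (use i in simp)
  then show "?s ! (k - 2) \<le> req n" "?s ! (k - 2) = req n \<or> ?s ! (k - 1) \<le> edge" by auto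
qed

text \<open>Requests for servers left of the window lie left of its first server, so the local
  instance copies the moves of that server.\<close>

lemma closest_window:
  assumes "lab n < j" "j \<le> k - 2"
  shows "closest (drop j (conf (Suc n))) (req n) = conf (Suc n) ! j"
proof -
  let ?s = "conf (Suc n)"
  have jk: "j < k" using assms two_le_k by linarith
  have "req n \<le> ?s ! j"
    using conf_near_target[of j "Suc n"] target_gap[of "lab n" j "tau (Suc n)"] tau_cases assms
      req_target[of n] width_ge by fastforce
  then show ?thesis
    using closest_hd[of "drop j ?s" "req n"] jk by (simp add: hd_drop_conv_nth sorted_wrt_drop)
qed

section \<open>Predicted cost inside the suffix windows\<close>

definition wreq :: "nat \<Rightarrow> nat \<Rightarrow> real" where
  "wreq j = win_req conf req (\<lambda>n. Suc (lab n)) j"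

definition wconf :: "nat \<Rightarrow> nat \<Rightarrow> config" where
  "wconf j = ftp_conf (drop j (conf 0)) (wreq j) (win_pred (\<lambda>n. Suc (lab n)) j)"

definition wcost :: "nat \<Rightarrow> nat \<Rightarrow> real" where
  "wcost j = ftp_sum (drop j (conf 0)) (wreq j) (win_pred (\<lambda>n. Suc (lab n)) j)"

definition travel :: "nat \<Rightarrow> nat \<Rightarrow> real" where
  "travel i n = (\<Sum>m<n. \<bar>conf m ! i - conf (Suc m) ! i\<bar>)"

text \<open>What the predicted path is compared with: the distance to this configuration serves as
  the potential.\<close>

definition ideal :: "real \<Rightarrow> nat \<Rightarrow> config" where
  "ideal x j = x # map home [Suc j..<k]"

text \<open>Truncated subtraction yields index 0 for all labels up to \<open>j\<close>, so one
  formula also covers the redirected predictions.\<close>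

lemma win_pred_index: "win_pred (\<lambda>n. Suc (lab n)) j n - 1 = lab n - j"
  by (auto simp: win_pred_def)

lemma wconf_Suc: "wconf j (Suc n) = sort ((wconf j n)[lab n - j := wreq j n])"
  and wcost_Suc: "wcost j (Suc n) = wcost j n + \<bar>wconf j n ! (lab n - j) - wreq j n\<bar>"
  by (simp_all only: wconf_def wcost_def ftp_conf.simps ftp_sum_def sum.lessThan_Suc win_pred_index)

lemma travel_Suc: "travel i (Suc n) = travel i n + \<bar>conf n ! i - conf (Suc n) ! i\<bar>"
  by (simp add: travel_def)

lemma wconf_sorted [simp]: "sorted (wconf j n)" and wconf_length [simp]: "length (wconf j n) = k - j"
  by (simp_all add: wconf_def)

lemma wreq_inside: "j \<le> lab n \<Longrightarrow> wreq j n = req n"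
  by (simp add: wreq_def win_req_def)

lemma wreq_outside: "lab n < j \<Longrightarrow> j \<le> k - 2 \<Longrightarrow> wreq j n = conf (Suc n) ! j"
  using closest_window by (simp add: wreq_def win_req_def)

lemma ideal_length: "j < k \<Longrightarrow> length (ideal x j) = k - j"
  by (simp add: ideal_def)

lemma ideal_nth: "j < i \<Longrightarrow> i < k \<Longrightarrow> ideal x j ! (i - j) = home i"
  by (simp add: ideal_def nth_Cons')

lemma ideal_sorted:
  assumes "x \<le> home (Suc j)"
  shows "sorted (ideal x j)"
proof -
  have "sorted (map home [Suc j..<k])"
    unfolding sorted_iff_nth_mono_less using home_mono by auto
  moreover have "x \<le> home i" if "Suc j \<le> i" "i < k" for i
    using assms home_mono[of "Suc j" i] that by (cases "i = Suc j") auto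
  ultimately show ?thesis by (auto simp: ideal_def)
qed

lemma ideal_dist: "move_cost (ideal x j) (ideal y j) \<le> \<bar>x - y\<bar>"
  unfolding ideal_def by (rule move_cost_Cons_same)

lemma ideal_triangle:
  assumes "j < k"
  shows "move_cost (wconf j n) (ideal y j) \<le> move_cost (wconf j n) (ideal x j) + \<bar>x - y\<bar>"
  using move_cost_triangle[of "wconf j n" "ideal x j" "ideal y j"] ideal_dist[of x j y] assms
  by (simp add: ideal_length)

lemma window_start: "j < k \<Longrightarrow> wcost j 0 + move_cost (wconf j 0) (ideal (conf 0 ! j) j) \<le> travel j 0"
proof -
  assume "j < k"
  then have "drop j (conf 0) = ideal (conf 0 ! j) j"
    by (simp add: conf_0 ideal_def drop_map upt_conv_Cons[of j])
  then show ?thesis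
    by (simp add: wcost_def ftp_sum_def wconf_def travel_def move_cost_def move_cost_on_def sorted_sort_id)
qed

text \<open>The first servers of the predicted and of the ideal configuration make the same jump,
  and the distance travelled by server \<open>j\<close> pays for it.\<close>

lemma window_first:
  assumes "j \<le> k - 2" "conf n ! j \<le> home (Suc j)" "lab n \<le> j" "wreq j n = conf (Suc n) ! j"
    and inv: "wcost j n + move_cost (wconf j n) (ideal (conf n ! j) j) \<le> travel j n"
  shows "wcost j (Suc n) + move_cost (wconf j (Suc n)) (ideal (conf (Suc n) ! j) j) \<le> travel j (Suc n)"
proof -
  have "k - j = Suc (k - Suc j)" using assms(1) two_le_k by linarith
  then show ?thesis
    using move_cost_serve_first[of "wconf j n" "conf n ! j" "map home [Suc j..<k]" "conf (Suc n) ! j"]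
      ideal_sorted[OF assms(2)] assms
    by (simp add: ideal_def wconf_Suc wcost_Suc travel_Suc)
qed

text \<open>Later servers are requested only at home, where the ideal configuration has them, so the
  potential alone pays.\<close>

lemma window_other:
  assumes "j < lab n" "x \<le> home (Suc j)"
  shows "wcost j (Suc n) + move_cost (wconf j (Suc n)) (ideal x j)
      \<le> wcost j n + move_cost (wconf j n) (ideal x j)"
proof -
  have "req n = home (lab n)"
    using req_target[of n] req_event[of n] lab_less[of n] assms home_last
    by (cases "lab n = k - 1") (auto simp: target_def)
  then show ?thesis
    using move_cost_serve_target[of "wconf j n" "ideal x j" "lab n - j" "req n"] assms lab_less[of n]
      ideal_sorted[OF assms(2)]
    by (simp add: ideal_length ideal_nth wconf_Suc wcost_Suc wreq_inside)
qed

text \<open>Servers below \<open>k - 2\<close> serve all requests predicted for them, so the first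
  server of the window is copied without exception.\<close>

lemma window_low:
  assumes "j < k - 2"
  shows "wcost j n + move_cost (wconf j n) (ideal (conf n ! j) j) \<le> travel j n"
proof (induction n)
  case 0
  then show ?case using assms by (intro window_start) simp
next
  case (Suc n)
  have near: "conf n ! j \<le> home (Suc j)"
    using conf_near_target[of j n] target_gap[of j "Suc j" "tau n"] tau_cases assms width_ge
    by (fastforce simp: target_def)
  show ?case
  proof (cases "lab n \<le> j")
    case True
    have "wreq j n = conf (Suc n) ! j"
      using wreq_outside[of n j] wreq_inside[of j n] served_low[of n] True assms
      by (cases "lab n = j") auto
    then show ?thesis using near Suc True assms by (intro window_first) auto
  next
    case False
    have "j < k" using assms by linarith
    then show ?thesis
      using window_other[of j n "conf n ! j"] near False Suc
        ideal_triangle[of j "Suc n" "conf (Suc n) ! j" "conf n ! j"] by (simp add: travel_Suc)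
  qed
qed

text \<open>Labels count from 0 here. In the window of the last two servers, server \<open>k - 1\<close> may serve a request predicted for
  server \<open>k - 2\<close>. Then the predicted path runs ahead of the server \<open>k - 2\<close> (second alternative)
  until that server has caught up; the adversary copies no position of it before.\<close>

lemma window_mid:
  defines "j \<equiv> k - 2"
  shows "wcost j n + move_cost (wconf j n) (ideal (conf n ! j) j) \<le> travel j n
    \<or> conf n ! j < target (tau n) j
      \<and> wcost j n + move_cost (wconf j n) (ideal (target (tau n) j) j)
         \<le> travel j n + (target (tau n) j - conf n ! j)"
    (is "?normal n \<or> ?ahead n")
proof (induction n)
  case 0
  then show ?case using window_start[of j] two_le_k by (simp add: j_def)
next
  case (Suc n)
  have jk: "j < k" and hj: "home (Suc j) = edge + 1" and Sj: "Suc j = k - 1"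
    using two_le_k home_last by (auto simp: j_def Suc_diff_Suc numeral_2_eq_2)
  let ?s = "conf n ! j" and ?s' = "conf (Suc n) ! j"
  have tri: "move_cost (wconf j (Suc n)) (ideal y j) \<le> move_cost (wconf j (Suc n)) (ideal x j) + \<bar>x - y\<bar>" for x y
    using jk by (rule ideal_triangle)
  have tl: "target (tau m) j \<le> edge" for m using tau_cases by (intro target_le_edge) (simp_all add: j_def)
  \<comment> \<open>The second alternative cannot hold here, as server \<open>j\<close> is not left
    of its target.\<close>
  have lower: ?case if "lab n < j" "target (tau n) j \<le> ?s" "?s \<le> target (tau n) j + 1 / 2"
  proof -
    have "?normal n" using Suc that by linarith
    then have "?normal (Suc n)"
      using that tl[of n] hj jk by (intro window_first wreq_outside) (auto simp: j_def)
    then show ?thesis by blast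
  qed
  \<comment> \<open>The predicted path goes to the target; server \<open>j\<close> itself may stop
    short of it, which leads to the second alternative.\<close>
  have own: ?case if lab: "lab n = j"
    and ahead: "?ahead n \<Longrightarrow> tau (Suc n) = tau n"
  proof -
    let ?r = "target (tau (Suc n)) j"
    have r: "req n = ?r" using req_target[of n] lab Sj by simp
    have "wcost j n + move_cost (wconf j n) (ideal ?r j) \<le> travel j n + \<bar>?s - ?r\<bar>"
      using Suc
    proof
      assume "?normal n"
      then show ?thesis using ideal_triangle[OF jk, of n ?r ?s] by linarith
    next
      assume "?ahead n"
      then show ?thesis using ahead by auto
    qed
    moreover have "\<bar>wconf j n ! 0 - ?r\<bar> + move_cost (wconf j (Suc n)) (ideal ?r j)
        \<le> move_cost (wconf j n) (ideal ?r j)"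
      using move_cost_serve_target[of "wconf j n" "ideal ?r j" 0 ?r] ideal_sorted[of ?r j] tl[of "Suc n"] hj jk
      by (simp add: ideal_length wconf_Suc wreq_inside lab r) (simp add: ideal_def)
    ultimately have *: "wcost j (Suc n) + move_cost (wconf j (Suc n)) (ideal ?r j) \<le> travel j n + \<bar>?s - ?r\<bar>"
      by (simp add: wcost_Suc wreq_inside lab r)
    have "?s' \<le> ?r" using served_mid(1)[of n] lab r by (simp add: j_def)
    then show ?thesis
    proof (cases "?s' = ?r")
      case True
      then show ?thesis using * by (simp add: travel_Suc)
    next
      case False
      then have "?s' < ?r" using \<open>?s' \<le> ?r\<close> by simp
      moreover have "\<bar>?s - ?r\<bar> \<le> \<bar>?s - ?s'\<bar> + (?r - ?s')" using \<open>?s' < ?r\<close> by linarith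
      ultimately show ?thesis using * by (simp add: travel_Suc)
    qed
  qed
  show ?case
  proof (cases n rule: step_cases)
    case event
    have sle: "?s \<le> edge" using conf_mono[of j "k - 1" n] event Sj by simp
    have labn: "j < lab n" using event Sj by simp
    from Suc show ?thesis
    proof
      assume "?normal n"
      then have "?normal (Suc n)"
        using window_other[OF labn, of ?s] sle hj tri[of ?s' ?s] by (simp add: travel_Suc)
      then show ?thesis ..
    next
      assume ahead: "?ahead n"
      let ?t = "target (tau n) j"
      have *: "wcost j (Suc n) + move_cost (wconf j (Suc n)) (ideal ?t j) \<le> travel j n + (?t - ?s)"
        using window_other[OF labn, of ?t] tl[of n] hj ahead by simp
      show ?thesis
      proof (cases "?s' < ?t")
        case True
        have "?t - ?s \<le> \<bar>?s - ?s'\<bar> + (?t - ?s')" by linarith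
        then have "?ahead (Suc n)" using True * event by (simp add: travel_Suc)
        then show ?thesis ..
      next
        case False
        then have "?normal (Suc n)" using * tri[of ?s' ?t] ahead by (simp add: travel_Suc)
        then show ?thesis ..
      qed
    qed
  next
    case mid
    then show ?thesis using own by (simp add: j_def)
  next
    case low
    then show ?thesis using lower by (simp add: j_def)
  next
    case calm
    then have s: "target (tau n) j \<le> ?s" "?s \<le> target (tau n) j + 1 / 2"
      by (auto simp: calm_def j_def abs_le_iff)
    show ?thesis
    proof (cases "j = 0")
      case True
      then show ?thesis using own calm s by simp
    next
      case False
      then show ?thesis using lower s calm by simp
    qed
  qed
qed

text \<open>The lead of the predicted path in the last window is at most the distance of server
  \<open>k - 2\<close> from its target.\<close>

lemma wcost_le_travel:
  assumes "j \<le> k - 2"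
  shows "wcost j n \<le> travel j n + width"
proof (cases "j = k - 2")
  case True
  then show ?thesis
    using window_mid[of n] conf_near_target[of j n] width_ge
      move_cost_nonneg[of "wconf j n" "ideal (conf n ! j) j"]
      move_cost_nonneg[of "wconf j n" "ideal (target (tau n) j) j"] by auto
next
  case False
  then show ?thesis
    using window_low[of j n] assms width_ge move_cost_nonneg[of "wconf j n" "ideal (conf n ! j) j"] by auto
qed

definition suffix_cost :: "nat \<Rightarrow> nat \<Rightarrow> real" where
  "suffix_cost j n = (\<Sum>i=j..<k. travel i n)"

lemma suffix_cost_bound:
  assumes "j \<le> k - 2"
  shows "suffix_cost j n \<le> rho lam (k - j) * (travel j n + width) + f (conf 0)"
proof -
  have jk: "j < k" using assms two_le_k by linarith
  have "suffix_cost j n = (\<Sum>m<n. move_cost_on {j..<k} (conf m) (conf (Suc m)))"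
    unfolding suffix_cost_def travel_def by (subst sum.swap) (simp add: move_cost_on_def sorted_sort_id)
  also have "\<dots> \<le> rho lam (k - j) * wcost j n + f (conf 0)"
    using window_bound[OF play_conf jk, of n]
    by (simp add: wcost_def wreq_def min_def split: if_splits)
  also have "rho lam (k - j) * wcost j n \<le> rho lam (k - j) * (travel j n + width)"
    using wcost_le_travel[OF assms] lam_pos by (intro mult_left_mono rho_nonneg)
  finally show ?thesis by simp
qed

section \<open>Comparing the algorithm with the optimum\<close>

lemma rho_Suc: "rho lam (Suc m) = 1 + lam * rho lam m"
  unfolding rho_def sum.lessThan_Suc_shift by (simp add: sum_distrib_left)

text \<open>The factor \<open>lam ^ m\<close> reverses the order of the terms of the geometric
  sum.\<close>

lemma beta_rho: "beta lam (Suc m) * lam ^ m = rho lam (Suc m)"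
proof (induction m)
  case (Suc m)
  have "beta lam (Suc (Suc m)) * lam ^ Suc m = lam * (beta lam (Suc m) * lam ^ m) + 1"
    using lam_pos by (simp add: beta_def power_divide field_simps)
  then show ?case unfolding Suc by (simp add: rho_Suc[of "Suc m"])
qed (simp add: beta_def rho_def)

lemma beta_step: "rho lam (Suc (Suc m)) * beta lam (Suc m) = lam * rho lam (Suc m) * beta lam (Suc (Suc m))"
  using lam_pos by (simp flip: beta_rho)

text \<open>With S_j for the suffix costs, inserting V_j = S_j - S_(j+1) into
  \<open>suffix_cost_bound\<close> gives rho(k-j) S_(j+1) \<le> lam rho(k-j-1) S_j + const, since
  rho(k-j) - 1 = lam rho(k-j-1). By \<open>beta_step\<close> these factors multiply up to
  \<open>beta\<close>.\<close>

lemma suffix_cost_ge: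
  assumes "j \<le> k - 1"
  shows "\<exists>c. \<forall>n. beta lam (k - j) * travel (k - 1) n \<le> suffix_cost j n + c"
  using assms
proof (induction rule: inc_induct)
  case base
  have "suffix_cost (k - 1) n = travel (k - 1) n" for n
  proof -
    have "{k - 1..<k} = {k - 1}" using two_le_k by auto
    then show ?thesis by (simp add: suffix_cost_def)
  qed
  moreover have "beta lam (k - (k - 1)) = 1" using two_le_k by (simp add: beta_def)
  ultimately show ?case by (intro exI[of _ 0]) simp
next
  case (step j)
  then obtain c where c: "\<And>n. beta lam (k - Suc j) * travel (k - 1) n \<le> suffix_cost (Suc j) n + c"
    by blast
  obtain m where m: "k - Suc j = Suc m" "k - j = Suc (Suc m)"
    using step(2) that[of "k - Suc (Suc j)"] by linarith
  let ?r = "rho lam (Suc (Suc m))" and ?r' = "rho lam (Suc m)"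
  let ?d = "?r * width + f (conf 0)"
  have div: "(x * z + y) / z = x + y / z" if "0 < z" for x y z :: real
    using that by (simp add: add_divide_distrib)
  have r': "0 < lam * ?r'" using lam_pos rho_nonneg[of lam m] by (simp add: rho_Suc add_pos_nonneg)
  have "beta lam (k - j) * travel (k - 1) n \<le> suffix_cost j n + (?d + ?r * c) / (lam * ?r')" for n
  proof -
    have split: "suffix_cost j n = travel j n + suffix_cost (Suc j) n"
      using step(2) by (simp add: suffix_cost_def sum.atLeast_Suc_lessThan)
    have "suffix_cost j n \<le> ?r * (travel j n + width) + f (conf 0)"
      using suffix_cost_bound[of j n] step(2) m by simp
    then have "?r * suffix_cost (Suc j) n \<le> (?r - 1) * suffix_cost j n + ?d"
      unfolding split by (simp add: algebra_simps)
    moreover have "?r * (beta lam (Suc m) * travel (k - 1) n) \<le> ?r * (suffix_cost (Suc j) n + c)"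
      using c[of n] m lam_pos by (intro mult_left_mono rho_nonneg) auto
    ultimately have "(?r * beta lam (Suc m)) * travel (k - 1) n
        \<le> lam * ?r' * suffix_cost j n + (?d + ?r * c)"
      by (simp add: rho_Suc[of "Suc m"] algebra_simps)
    then have "(beta lam (k - j) * travel (k - 1) n) * (lam * ?r')
        \<le> suffix_cost j n * (lam * ?r') + (?d + ?r * c)"
      unfolding beta_step m by (simp add: mult_ac)
    then have "beta lam (k - j) * travel (k - 1) n
        \<le> (suffix_cost j n * (lam * ?r') + (?d + ?r * c)) / (lam * ?r')"
      using r' by (simp only: pos_le_divide_eq)
    also have "\<dots> = suffix_cost j n + (?d + ?r * c) / (lam * ?r')"
      using r' by (rule div)
    finally show ?thesis .
  qed
  then show ?case by blast
qed

section \<open>The cost of the algorithm is unbounded\<close>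

lemma step_le_move: "i < k \<Longrightarrow> \<bar>conf n ! i - conf (Suc n) ! i\<bar> \<le> move_cost (conf n) (conf (Suc n))"
  using play_drift[OF play_conf, of n "Suc n" i] by (simp add: abs_minus_commute)

lemma event_cost:
  assumes "lab n = k - 1"
  shows "conf n ! (k - 1) \<le> edge" "edge + 1 \<le> conf (Suc n) ! (k - 1)"
proof -
  obtain i where "i < k" "conf (Suc n) ! i = edge + 1"
    using served[of n] req_event[OF assms] by (auto simp: in_set_conv_nth)
  then show "edge + 1 \<le> conf (Suc n) ! (k - 1)" using conf_mono[of i "k - 1" "Suc n"] by simp
qed (use req_event[OF assms] in simp)

lemma event_move: "lab n = k - 1 \<Longrightarrow> 1 / 2 \<le> move_cost (conf n) (conf (Suc n))"
  using event_cost[of n] step_le_move[of "k - 1" n] two_le_k by auto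

lemma total_cost: "suffix_cost 0 n = (\<Sum>m<n. move_cost (conf m) (conf (Suc m)))"
  unfolding suffix_cost_def travel_def
  by (subst sum.swap) (simp add: move_cost_sorted l1_dist_def atLeast0LessThan)

lemma event_next: "conf n ! (k - 1) \<le> edge \<Longrightarrow> lab n = k - 1"
  by (cases n rule: step_cases) (auto simp: calm_def)

text \<open>A step cheaper than 1 / 2 either lets server \<open>k - 1\<close> come down, and a
  costly event follows, or puts server \<open>k - 2\<close> exactly on its target, which cannot
  happen twice in a row.\<close>

lemma three_steps_cost: "suffix_cost 0 n + 1 / 2 \<le> suffix_cost 0 (n + 3)"
proof -
  let ?x = "\<lambda>n. move_cost (conf n) (conf (Suc n))"
  have flip: "1 / 2 \<le> ?x m" if "calm m" "conf (Suc m) ! 0 = 1 - tau m" for m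
  proof -
    have "\<bar>conf m ! 0 - tau m\<bar> \<le> 1 / 2"
      using that(1) by (auto simp: calm_def target_def dest: spec[of _ 0])
    moreover have "\<bar>tau m - (1 - tau m)\<bar> = 1" using tau_cases[of m] by auto
    ultimately have "1 / 2 \<le> \<bar>conf m ! 0 - conf (Suc m) ! 0\<bar>" unfolding that(2) by linarith
    then show ?thesis using step_le_move[of 0 m] two_le_k by linarith
  qed
  have moves: "1 / 2 \<le> ?x m \<or> lab (Suc m) = k - 1
      \<or> (edge < conf m ! (k - 1) \<and> conf (Suc m) ! (k - 2) = target (tau (Suc m)) (k - 2)
         \<and> \<not> (target (tau m) (k - 2) \<le> conf m ! (k - 2) \<and> conf m ! (k - 2) \<le> target (tau m) (k - 2) + 1 / 2))" for m
  proof (cases m rule: step_cases)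
    case event
    then show ?thesis using event_move by blast
  next
    case mid
    then show ?thesis using served_mid(2)[of m] event_next[of "Suc m"] by auto
  next
    case low
    then show ?thesis using served_low[of m] step_le_move[of "lab m" m] lab_less[of m] by simp
  next
    case calm
    show ?thesis
    proof (cases "k = 2")
      case True
      then have "lab m = k - 2" "k - 2 = 0" using calm by auto
      then show ?thesis
        using served_mid(2)[of m] event_next[of "Suc m"] flip[OF calm(1)] calm(3) by metis
    next
      case False
      then show ?thesis using served_low[of m] flip[OF calm(1)] calm two_le_k by simp
    qed
  qed
  have "1 / 2 \<le> ?x n \<or> 1 / 2 \<le> ?x (Suc n) \<or> 1 / 2 \<le> ?x (Suc (Suc n))"
    using moves[of n] moves[of "Suc n"] event_move[of "Suc n"] event_move[of "Suc (Suc n)"] by force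
  moreover have "suffix_cost 0 (n + 3) = suffix_cost 0 n + ?x n + ?x (Suc n) + ?x (Suc (Suc n))"
    by (simp add: total_cost numeral_3_eq_3)
  moreover have "0 \<le> ?x m" for m by (rule move_cost_nonneg)
  ultimately show ?thesis by (smt (verit))
qed

lemma total_cost_unbounded: "real n / 2 \<le> suffix_cost 0 (3 * n)"
proof (induction n)
  case 0
  then show ?case by (simp add: total_cost)
next
  case (Suc n)
  then show ?case using three_steps_cost[of "3 * n"] by (simp add: algebra_simps)
qed

section \<open>An offline schedule that pays only for events\<close>

definition events :: "nat \<Rightarrow> real" where
  "events n = (\<Sum>m<n. of_bool (lab m = k - 1))"

lemma events_Suc: "events (Suc n) = events n + of_bool (lab n = k - 1)"
  unfolding events_def by (rule sum.lessThan_Suc)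

text \<open>Each event finds the last server at \<open>edge\<close> or below and leaves it at
  \<open>edge + 1\<close> or above; the extra term carries the way covered between two
  events.\<close>

lemma travel_last: "2 * events n + \<bar>edge + 1 - conf n ! (k - 1)\<bar> \<le> travel (k - 1) n"
proof (induction n)
  case 0
  then show ?case using two_le_k home_last by (simp add: events_def travel_def conf_0)
next
  case (Suc n)
  show ?case
  proof (cases "lab n = k - 1")
    case True
    then show ?thesis using Suc event_cost[OF True] by (simp add: events_Suc travel_Suc)
  next
    case False
    then have "events (Suc n) = events n" by (simp add: events_Suc)
    then show ?thesis using Suc unfolding travel_Suc by linarith
  qed
qed

text \<open>Covers both positions of the first target and all homes but the last. Its last entry is
  \<open>edge\<close> (for \<open>k = 2\<close> the entry 1), so moving over for an event costs
  1.\<close>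

definition opt_main :: config where
  "opt_main = 0 # 1 # map home [1..<k - 1]"

definition opt_conf :: "nat \<Rightarrow> config" where
  "opt_conf n = (case n of 0 \<Rightarrow> conf 0
     | Suc m \<Rightarrow> if lab m = k - 1 then opt_main[k - 1 := edge + 1] else opt_main)"

lemma opt_main_length: "length opt_main = k"
  using two_le_k by (simp add: opt_main_def)

lemma opt_main_last: "opt_main ! (k - 1) = edge"
proof (cases "k = 2")
  case True
  then have "k - 1 = 1" by simp
  moreover have "edge = 1" using True unfolding edge_def by simp
  ultimately show ?thesis by (simp add: opt_main_def)
next
  case False
  then have idx: "k - 1 = Suc (Suc (k - 3))" "1 + (k - 3) = k - 2" "k - 3 < k - 1 - 1" using two_le_k by auto
  have "opt_main ! Suc (Suc (k - 3)) = home (1 + (k - 3))"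
    using idx(3) by (simp add: opt_main_def del: upt_Suc)
  moreover have "home (k - 2) = edge" using False two_le_k by (auto simp: home_def edge_def)
  ultimately show ?thesis using idx by metis
qed

lemma opt_conf_length: "length (opt_conf n) = k"
  by (cases n) (auto simp: opt_conf_def opt_main_length)

lemma opt_conf_serves: "req n \<in> set (opt_conf (Suc n))"
proof (cases "lab n = k - 1")
  case True
  then show ?thesis
    using req_event[OF True] two_le_k opt_main_length
    by (auto simp: opt_conf_def intro!: set_update_memI)
next
  case False
  then have l: "lab n < k - 1" using lab_less[of n] by linarith
  then have "req n = target (tau (Suc n)) (lab n)" by (rule req_target)
  then show ?thesis using False l tau_cases[of "Suc n"]
    by (cases "lab n = 0") (auto simp: opt_conf_def opt_main_def target_def Suc_le_eq)
qed

lemma opt_switch: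
  "move_cost opt_main (opt_main[k - 1 := edge + 1]) \<le> 1"
  "move_cost (opt_main[k - 1 := edge + 1]) opt_main \<le> 1"
proof -
  have "l1_dist (opt_main[k - 1 := edge + 1]) opt_main = 1"
    using two_le_k opt_main_length opt_main_last by (simp add: l1_dist_update) (simp add: l1_dist_def)
  then show "move_cost (opt_main[k - 1 := edge + 1]) opt_main \<le> 1"
    using move_cost_le_l1[of "opt_main[k - 1 := edge + 1]" opt_main] by simp
  then show "move_cost opt_main (opt_main[k - 1 := edge + 1]) \<le> 1"
    by (subst move_cost_commute) simp_all
qed

text \<open>An event costs 1 for the way to \<open>edge + 1\<close> and 1 for the return; the
  subtracted term is a return still outstanding.\<close>

lemma opt_path_cost:
  "(\<Sum>m<Suc n. move_cost (opt_conf m) (opt_conf (Suc m)))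
     \<le> move_cost (conf 0) opt_main + 2 * events (Suc n) - of_bool (lab n = k - 1)"
proof (induction n)
  case 0
  have "lab 0 \<noteq> k - 1" using calm_0 req_event[of 0] by (auto simp: calm_def)
  then show ?case by (simp add: opt_conf_def events_def)
next
  case (Suc n)
  have "move_cost opt_main opt_main = 0"
    "move_cost (opt_main[k - 1 := edge + 1]) (opt_main[k - 1 := edge + 1]) = 0"
    by (simp_all add: move_cost_def move_cost_on_def)
  then have "move_cost (opt_conf (Suc n)) (opt_conf (Suc (Suc n)))
      \<le> of_bool (lab n = k - 1) + of_bool (lab (Suc n) = k - 1)"
    using opt_switch by (auto simp: opt_conf_def)
  then show ?case using Suc by (simp add: events_def)
qed

lemma OPT_bounds:
  "0 \<le> OPT (conf 0) (map req [0..<Suc n])"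
  "OPT (conf 0) (map req [0..<Suc n]) \<le> move_cost (conf 0) opt_main + 2 * events (Suc n)"
proof -
  let ?rs = "map req [0..<Suc n]"
  define Ds where "Ds = map (\<lambda>m. opt_conf (Suc m)) [0..<Suc n]"
  have "conf 0 # Ds = map opt_conf [0..<Suc (Suc n)]"
    unfolding Ds_def upt_Suc_shift[of "Suc n"] by (simp add: opt_conf_def del: upt_Suc)
  moreover have "path_cost (conf 0 # Ds) = path_cost_on {..<k} (conf 0 # Ds)"
    by (simp add: path_cost_def)
  ultimately have eq: "path_cost (conf 0 # Ds) = (\<Sum>m<Suc n. move_cost (opt_conf m) (opt_conf (Suc m)))"
    using path_cost_on_sequence[of 0 "Suc n" "{..<k}" opt_conf]
    by (simp add: move_cost_def opt_conf_length atLeast0LessThan del: upt_Suc sum.lessThan_Suc)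
  have "length Ds = length ?rs" by (simp add: Ds_def)
  moreover have "length (Ds ! t) = length (conf 0) \<and> ?rs ! t \<in> set (Ds ! t)" if "t < length ?rs" for t
    using that opt_conf_serves opt_conf_length by (simp add: Ds_def del: upt_Suc)
  ultimately have "0 \<le> OPT (conf 0) ?rs \<and> OPT (conf 0) ?rs \<le> path_cost (conf 0 # Ds)"
    using OPT_between by blast
  moreover have "0 \<le> (of_bool (lab n = k - 1) :: real)" by simp
  ultimately show "0 \<le> OPT (conf 0) ?rs" "OPT (conf 0) ?rs \<le> move_cost (conf 0) opt_main + 2 * events (Suc n)"
    using opt_path_cost[of n] eq by linarith+
qed

lemma alg_cost_total:
  "alg_cost A (conf 0) (map req [0..<n]) (map (\<lambda>n. Suc (lab n)) [0..<n]) = suffix_cost 0 n"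
proof -
  have "hd (map conf [0..<Suc n]) = conf 0" by (simp add: upt_conv_Cons del: upt_Suc)
  then show ?thesis
    using path_cost_on_sequence[of 0 n "{..<k}" conf]
    by (simp add: alg_cost_def path_cost_def play_run[OF play_conf] total_cost move_cost_def
        atLeast0LessThan del: upt_Suc)
qed

text \<open>The cost is at least \<open>beta\<close> times the travel of the last server, and the
  optimum at most that travel, up to constants. Robustness thus bounds the travel, hence the optimum
  and the cost, but the cost is unbounded.\<close>

lemma not_robust:
  assumes "b < beta lam k"
  shows "\<not> robust k b A"
proof
  assume "robust k b A"
  then obtain c where c: "\<And>rs ps. valid_instance k (conf 0) rs ps \<Longrightarrow>
      alg_cost A (conf 0) rs ps \<le> b * OPT (conf 0) rs + c"
    using play_valid[OF play_conf, of 0] unfolding robust_def by blast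
  \<comment> \<open>The upper bound on the optimum can be inserted only with a nonnegative
    factor.\<close>
  define b' where "b' = max b 0"
  define M where "M = move_cost (conf 0) opt_main"
  have "0 < beta lam k" unfolding beta_def using lam_pos two_le_k by (intro sum_pos) (auto simp: lessThan_empty_iff)
  then have b': "0 \<le> b'" "b \<le> b'" "b' < beta lam k" using assms by (auto simp: b'_def)
  have upper: "suffix_cost 0 (Suc n) \<le> b' * (M + travel (k - 1) (Suc n)) + c" for n
  proof -
    let ?O = "OPT (conf 0) (map req [0..<Suc n])"
    have "suffix_cost 0 (Suc n) \<le> b * ?O + c"
      using c[OF play_instance[OF play_conf, of "Suc n"]] unfolding alg_cost_total .
    also have "b * ?O \<le> b' * ?O" using b' OPT_bounds(1)[of n] by (intro mult_right_mono) auto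
    also have "\<dots> \<le> b' * (M + travel (k - 1) (Suc n))"
      using b' OPT_bounds(2)[of n] travel_last[of "Suc n"] by (intro mult_left_mono) (auto simp: M_def)
    finally show ?thesis by simp
  qed
  obtain d where d: "\<And>n. beta lam k * travel (k - 1) n \<le> suffix_cost 0 n + d"
    using suffix_cost_ge[of 0] by auto
  define g where "g = beta lam k - b'"
  have g: "0 < g" using b' by (simp add: g_def)
  define Q where "Q = (b' * M + c + d) / g"
  have "travel (k - 1) (Suc n) \<le> Q" for n
  proof -
    have "g * travel (k - 1) (Suc n) \<le> b' * M + c + d"
      using d[of "Suc n"] upper[of n] by (simp add: g_def algebra_simps)
    then show ?thesis using g by (simp add: Q_def pos_le_divide_eq mult.commute)
  qed
  then have bounded: "suffix_cost 0 (Suc n) \<le> b' * (M + Q) + c" for n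
    using upper[of n] b' by (smt (verit) mult_left_mono)
  obtain n where n: "2 * (b' * (M + Q) + c) < real n" using reals_Archimedean2 by blast
  have "real (Suc n) / 2 \<le> suffix_cost 0 (Suc (3 * n + 2))"
    using total_cost_unbounded[of "Suc n"] by (simp add: numeral_eq_Suc)
  then show False using bounded[of "3 * n + 2"] n by simp
qed

end

text \<open>A single server has to follow the requests, and on alternating points its path is itself
  a feasible offline solution of unbounded cost.\<close>

lemma one_server_not_robust:
  assumes A: "valid_alg A" and b: "b < beta lam 1"
  shows "\<not> robust 1 b A"
proof
  assume "robust 1 b A"
  then obtain c where c: "\<And>rs ps. valid_instance 1 [0] rs ps \<Longrightarrow>
      alg_cost A [0] rs ps \<le> b * OPT [0] rs + c"
    unfolding robust_def valid_config_def by (metis One_nat_def length_Cons list.size(3) sorted1)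
  define r :: "nat \<Rightarrow> real" where "r n = of_bool (even n)" for n
  define x where "x n = [of_bool (odd n) :: real]" for n :: nat
  have "A [u] v 1 = [v]" for u v
    using A[unfolded valid_alg_def, rule_format, of "[u]" 1 v]
    by (auto simp: length_Suc_conv)
  then have run: "alg_run A [0] (map r [0..<n]) (map (\<lambda>_. 1) [0..<n]) = map x [0..<Suc n]" for n
    using alg_run_sequence[of x A r "\<lambda>_. 1" 0 n] by (simp add: x_def r_def del: upt_Suc)
  have hd: "hd (map x [0..<Suc n]) = [0]" for n by (simp add: x_def upt_conv_Cons del: upt_Suc)
  have cost: "path_cost (map x [0..<Suc n]) = real n" for n
  proof -
    have "\<bar>of_bool (odd i) - of_bool (even i)\<bar> = (1::real)" for i :: nat by (cases "even i") auto
    then show ?thesis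
      unfolding path_cost_def hd path_cost_on_sequence[OF le0] by (simp add: move_cost_on_def x_def)
  qed
  have OPT: "0 \<le> OPT [0] (map r [0..<n]) \<and> OPT [0] (map r [0..<n]) \<le> real n" for n
  proof -
    have "map x [0..<Suc n] = [0] # map (\<lambda>m. x (Suc m)) [0..<n]"
      unfolding upt_Suc_shift by (simp add: x_def)
    then have "path_cost ([0] # map (\<lambda>m. x (Suc m)) [0..<n]) = real n"
      using cost[of n] by (simp del: upt_Suc)
    then show ?thesis
      using OPT_between[of "map (\<lambda>m. x (Suc m)) [0..<n]" "map r [0..<n]" "[0]"]
      by (simp add: x_def r_def)
  qed
  define b' where "b' = max b 0"
  have b': "0 \<le> b'" "b \<le> b'" "b' < 1" using b by (auto simp: b'_def beta_def)
  have "real n \<le> b' * real n + c" for n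
  proof -
    have "valid_instance 1 [0] (map r [0..<n]) (map (\<lambda>_. 1) [0..<n])"
      by (simp add: valid_instance_def valid_config_def valid_preds_def)
    from c[OF this] have "real n \<le> b * OPT [0] (map r [0..<n]) + c"
      unfolding alg_cost_def run cost .
    also have "b * OPT [0] (map r [0..<n]) \<le> b' * real n"
      using b' OPT[of n] by (intro mult_mono) auto
    finally show ?thesis by simp
  qed
  then have "(1 - b') * real n \<le> c" for n by (simp add: algebra_simps)
  moreover obtain n where "c < real n * (1 - b')" using reals_Archimedean3[of "1 - b'"] b' by auto
  ultimately show False by (metis mult.commute not_le)
qed

theorem theorem2:
  fixes lam :: real and k :: nat and A :: alg
  assumes "0 < lam" and "lam \<le> 1" and "1 \<le> k"
    and "valid_alg A"
    and "memory_constrained A"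
    and "locally_consistent (rho lam) A"
    and "consistent k (rho lam k) A"
  shows "\<forall>\<beta>'. \<beta>' < beta lam k \<longrightarrow> \<not> robust k \<beta>' A"
proof (cases "k = 1")
  case True
  then show ?thesis using one_server_not_robust[OF assms(4)] by simp
next
  case False
  obtain K f where "0 \<le> K" "\<forall>k C rs ps j k'.
       valid_instance k C rs ps \<longrightarrow> 1 \<le> k' \<longrightarrow> j + k' \<le> k \<longrightarrow>
       path_cost_on {j..<j+k'} (alg_run A C rs ps)
         \<le> rho lam k' * ftp_cost (take k' (drop j C)) (local_req A C rs ps j k') (local_pred ps j k')
           + min (f C) (K * real k' * move_cost C (last (alg_run A C rs ps)))"
    using assms(6) unfolding locally_consistent_def by blast
  then interpret adversary lam A K f k
    using assms False by unfold_locales auto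
  show ?thesis using not_robust by blast
qed

end
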